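(* Let $\mathcal H=(\mathcal H_L,\mathcal H_R,S)$ be a Hopf algebroid with bijective antipode and let $A$ be a right $\mathcal H$-comodule algebra. Then the $R$-$R$ bimodule map $$\psi:H\otimes_R A\to A\otimes_R H,\qquad h\otimes_R a\mapsto a^{\langle0\rangle}\otimes_R h\,a^{\langle1\rangle},$$ where $a\mapsto a^{\langle0\rangle}\otimes_R a^{\langle1\rangle}$ is the right $\mathcal H_R$-coaction on $A$, is an isomorphism.
   Context: Conventions. $k$ is a commutative ring; "algebra" means associative unital $k$-algebra. For an algebra $R$, an $R$-ring is a monoid and an $R$-coring is a comonoid in the monoidal category of $R$-$R$ bimodules. Summation is implied in all Sweedler-type notations. Left bialgebroid $(H,L,s,t,\gamma,\pi)$: algebras $H,L$; algebra maps $s:L\to H$, $t:L^{op}\to H$ with commuting images; an $L$-coring structure $(H,\gamma,\pi)$ on the bimodule $l\cdot h\cdot l'=s(l)t(l')h$, with $\gamma(h)=h_{(1)}\otimes_L h_{(2)}$, such that $h_{(1)}t(l)\otimes_L h_{(2)}=h_{(1)}\otimes_L h_{(2)}s(l)$, $\gamma(1_H)=1_H\otimes_L 1_H$, $\gamma(hh')=\gamma(h)\gamma(h')$, $\pi(1_H)=1_L$, $\pi(h\,s(\pi(h')))=\pi(hh')=\pi(h\,t(\pi(h')))$. Right bialgebroid $(H,R,s,t,\gamma,\pi)$: algebras $H,R$; algebra maps $s:R\to H$, $t:R^{op}\to H$ with commuting images; an $R$-coring structure $(H,\gamma,\pi)$ on the bimodule $r\cdot h\cdot r'=h\,t(r)s(r')$,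 with $\gamma(h)=h^{(1)}\otimes_R h^{(2)}$, such that $s(r)h^{(1)}\otimes_R h^{(2)}=h^{(1)}\otimes_R t(r)h^{(2)}$, $\gamma(1_H)=1_H\otimes_R 1_H$, $\gamma(hh')=\gamma(h)\gamma(h')$, $\pi(1_H)=1_R$, $\pi(s(\pi(h))h')=\pi(hh')=\pi(t(\pi(h))h')$. Hopf algebroid $\mathcal H=(\mathcal H_L,\mathcal H_R,S)$: a left bialgebroid $\mathcal H_L=(H,L,s_L,t_L,\gamma_L,\pi_L)$ and a right bialgebroid $\mathcal H_R=(H,R,s_R,t_R,\gamma_R,\pi_R)$ on the same algebra $H$, and a $k$-module map $S:H\to H$ (the antipode), with $\gamma_L(h)=h_{(1)}\otimes_L h_{(2)}$, $\gamma_R(h)=h^{(1)}\otimes_R h^{(2)}$, such that (i) $s_L\pi_Lt_R=t_R$, $t_L\pi_Ls_R=s_R$, $s_R\pi_Rt_L=t_L$, $t_R\pi_Rs_L=s_L$; (ii) $(\gamma_L\otimes_R H)\gamma_R=(H\otimes_L\gamma_R)\gamma_L$ and $(\gamma_R\otimes_L H)\gamma_L=(H\otimes_R\gamma_L)\gamma_R$ (tensor products over $L$ with respect to $h\cdot l=t_L(l)h$, $l\cdot h=s_L(l)h$, and over $R$ with respect to $h\cdot r=hs_R(r)$, $r\cdot h=ht_R(r)$); (iii) $S(t_L(l)ht_L(l'))=s_L(l')S(h)s_L(l)$ and $S(t_R(r)ht_R(r'))=s_R(r')S(h)s_R(r)$; (iv) $S(h_{(1)})h_{(2)}=s_R(\pi_R(h))$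 and $h^{(1)}S(h^{(2)})=s_L(\pi_L(h))$. Comodules and comodule algebras. A right comodule of a right bialgebroid $\mathcal H_R$ is a right comodule $(M,\tau_R)$ of the $R$-coring $(H,\gamma_R,\pi_R)$, $\tau_R(m)=m^{\langle0\rangle}\otimes_R m^{\langle1\rangle}$; it is an $R$-$R$ bimodule with left action $r\cdot m=m^{\langle0\rangle}\cdot\pi_R(s_R(r)m^{\langle1\rangle})$, and satisfies $r\cdot m^{\langle0\rangle}\otimes_R m^{\langle1\rangle}=m^{\langle0\rangle}\otimes_R t_R(r)m^{\langle1\rangle}$. A right $\mathcal H_R$-comodule algebra is an $R$-ring $A$ (with this bimodule structure) which is a right $\mathcal H_R$-comodule with $\tau_R(1_A)=1_A\otimes_R1_H$ and $\tau_R(aa')=a^{\langle0\rangle}a'^{\langle0\rangle}\otimes_R a^{\langle1\rangle}a'^{\langle1\rangle}$. A right comodule of a left bialgebroid $\mathcal H_L$ is a right comodule $(M,\tau_L)$ of the $L$-coring $(H,\gamma_L,\pi_L)$, $\tau_L(m)=m_{\langle0\rangle}\otimes_L m_{\langle1\rangle}$; it is an $L$-$L$ bimodule with left action $l\cdot m=m_{\langle0\rangle}\cdot\pi_L(m_{\langle1\rangle}s_L(l))$, and satisfies $l\cdot m_{\langle0\rangle}\otimes_L m_{\langle1\rangle}=m_{\langle0\rangle}\otimes_L m_{\langle1\rangle}s_L(l)$. A right $\mathcal H_L$-comodule algebra is an algebra $A$ which is a right $\mathcal H_L$-comodule and an $L^{op}$-ring, i.e. $a\cdot l=(1_A\cdot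 l)a$, $l\cdot a=a(1_A\cdot l)$, $l\cdot 1_A=1_A\cdot l$, with $\tau_L(1_A)=1_A\otimes_L1_H$ and $\tau_L(aa')=a_{\langle0\rangle}a'_{\langle0\rangle}\otimes_L a_{\langle1\rangle}a'_{\langle1\rangle}$. A right comodule of the Hopf algebroid $\mathcal H$ is a triple $(M,\tau_L,\tau_R)$ with $(M,\tau_R)$ a right $\mathcal H_R$-comodule and $(M,\tau_L)$ a right $\mathcal H_L$-comodule such that $l\cdot m\cdot l'=\pi_R(t_L(l'))\cdot m\cdot\pi_R(t_L(l))$ for $l,l'\in L$, and $(\tau_R\otimes_LH)\tau_L=(M\otimes_R\gamma_L)\tau_R$, $(\tau_L\otimes_RH)\tau_R=(M\otimes_L\gamma_R)\tau_L$. A right $\mathcal H$-comodule algebra is a right $\mathcal H$-comodule $(A,\tau_L,\tau_R)$ such that $A$ is an algebra, $(A,\tau_R)$ is a right $\mathcal H_R$-comodule algebra and $(A,\tau_L)$ is a right $\mathcal H_L$-comodule algebra. In $\psi$, the tensor products $H\otimes_RA$ and $A\otimes_RH$ use the $R$-$R$ bimodule structure $r\cdot h\cdot r'=h\,t_R(r)s_R(r')$ of $H$. *)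

theory Defs
  imports "HOL-Library.Multiset"
begin

text \<open>
  Rings are types of sort \<open>{ring, monoid_mult}\<close> (respectively \<open>{comm_ring, comm_monoid_mult}\<close>):
  this is \<open>ring_1\<close> (\<open>comm_ring_1\<close>) without the axiom \<open>0 \<noteq> 1\<close>, so that zero rings are allowed.
  For the same reason the locales of \<open>HOL.Modules\<close>, which need \<open>comm_ring_1\<close> scalars, are not used.
\<close>

section \<open>Modules, algebras and bimodules over a commutative ring\<close>

locale k_module =
  fixes scale :: "'k::{comm_ring,comm_monoid_mult} \<Rightarrow> 'm::ab_group_add \<Rightarrow> 'm"
  assumes scale_add_right: "scale c (x + y) = scale c x + scale c y"
    and scale_add_left: "scale (c + d) x = scale c x + scale d x"
    and scale_scale: "scale c (scale d x) = scale (c * d) x"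
    and scale_one: "scale 1 x = x"

locale k_algebra = k_module scale
  for scale :: "'k::{comm_ring,comm_monoid_mult} \<Rightarrow> 'a::{ring,monoid_mult} \<Rightarrow> 'a" +
  assumes scale_mult_left: "scale c x * y = scale c (x * y)"
    and scale_mult_right: "x * scale c y = scale c (x * y)"

definition k_linear ::
    "('k \<Rightarrow> 'm::ab_group_add \<Rightarrow> 'm) \<Rightarrow> ('k \<Rightarrow> 'n::ab_group_add \<Rightarrow> 'n) \<Rightarrow> ('m \<Rightarrow> 'n) \<Rightarrow> bool"
  where "k_linear scM scN f \<longleftrightarrow>
    (\<forall>x y. f (x + y) = f x + f y) \<and> (\<forall>c x. f (scM c x) = scN c (f x))"

definition algebra_map ::
    "('k \<Rightarrow> 'a::{ring,monoid_mult} \<Rightarrow> 'a) \<Rightarrow> ('k \<Rightarrow> 'b::{ring,monoid_mult} \<Rightarrow> 'b) \<Rightarrow> ('a \<Rightarrow> 'b) \<Rightarrow> bool"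
  where "algebra_map scA scB f \<longleftrightarrow>
    k_linear scA scB f \<and> f 1 = 1 \<and> (\<forall>x y. f (x * y) = f x * f y)"

text \<open>Algebra maps from the opposite of the algebra \<open>'a\<close> to \<open>'b\<close>.\<close>

definition algebra_op_map ::
    "('k \<Rightarrow> 'a::{ring,monoid_mult} \<Rightarrow> 'a) \<Rightarrow> ('k \<Rightarrow> 'b::{ring,monoid_mult} \<Rightarrow> 'b) \<Rightarrow> ('a \<Rightarrow> 'b) \<Rightarrow> bool"
  where "algebra_op_map scA scB f \<longleftrightarrow>
    k_linear scA scB f \<and> f 1 = 1 \<and> (\<forall>x y. f (x * y) = f y * f x)"

text \<open>The \<open>k\<close>-module structure of a module over a \<open>k\<close>-algebra is the one induced by the action;
  in a bimodule, left and right action induce the same one.\<close>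

locale right_module = B: k_algebra scB + M: k_module scM
  for scB :: "'k::{comm_ring,comm_monoid_mult} \<Rightarrow> 'b::{ring,monoid_mult} \<Rightarrow> 'b"
    and scM :: "'k \<Rightarrow> 'm::ab_group_add \<Rightarrow> 'm" +
  fixes ract :: "'m \<Rightarrow> 'b \<Rightarrow> 'm"
  assumes ract_add_left: "ract (x + y) b = ract x b + ract y b"
    and ract_add_right: "ract x (b + b') = ract x b + ract x b'"
    and ract_mult: "ract x (b * b') = ract (ract x b) b'"
    and ract_one: "ract x 1 = x"
    and ract_scale: "ract x (scB c 1) = scM c x"

locale bimodule = right_module scB scM ract
  for scB :: "'k::{comm_ring,comm_monoid_mult} \<Rightarrow> 'b::{ring,monoid_mult} \<Rightarrow> 'b"
    and scM :: "'k \<Rightarrow> 'm::ab_group_add \<Rightarrow> 'm"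
    and lact :: "'b \<Rightarrow> 'm \<Rightarrow> 'm"
    and ract :: "'m \<Rightarrow> 'b \<Rightarrow> 'm" +
  assumes lact_add_right: "lact b (x + y) = lact b x + lact b y"
    and lact_add_left: "lact (b + b') x = lact b x + lact b' x"
    and lact_mult: "lact (b * b') x = lact b (lact b' x)"
    and lact_one: "lact 1 x = x"
    and lact_scale: "lact (scB c 1) x = scM c x"
    and lact_ract: "ract (lact b x) b' = lact b (ract x b')"

section \<open>Tensor products over noncommutative rings\<close>

text \<open>
  The multiset \<open>{#(m\<^sub>1, n\<^sub>1), \<dots>, (m\<^sub>k, n\<^sub>k)#}\<close> is the formal sum \<open>m\<^sub>1 \<otimes> n\<^sub>1 + \<dots> + m\<^sub>k \<otimes> n\<^sub>k\<close>, and
  \<open>M \<otimes>\<^sub>B N\<close> is the set \<open>UNIV // tensor ract lact\<close> of classes of formal sums under the additive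
  congruence generated by biadditivity and \<open>m \<cdot> b \<otimes> n = m \<otimes> b \<cdot> n\<close>.  Formal sums need no negative
  coefficients, because \<open>(-m) \<otimes> n\<close> is an additive inverse of \<open>m \<otimes> n\<close>.
\<close>

inductive_set additive_congruence ::
    "('x multiset \<times> 'x multiset) set \<Rightarrow> ('x multiset \<times> 'x multiset) set"
  for E :: "('x multiset \<times> 'x multiset) set"
  where
    base: "(x, y) \<in> E \<Longrightarrow> (x, y) \<in> additive_congruence E"
  | refl: "(x, x) \<in> additive_congruence E"
  | sym: "(x, y) \<in> additive_congruence E \<Longrightarrow> (y, x) \<in> additive_congruence E"
  | trans: "\<lbrakk>(x, y) \<in> additive_congruence E; (y, z) \<in> additive_congruence E\<rbrakk>
      \<Longrightarrow> (x, z) \<in> additive_congruence E"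
  | add: "\<lbrakk>(x, y) \<in> additive_congruence E; (u, v) \<in> additive_congruence E\<rbrakk>
      \<Longrightarrow> (x + u, y + v) \<in> additive_congruence E"

definition tensor ::
    "('m::ab_group_add \<Rightarrow> 'b \<Rightarrow> 'm) \<Rightarrow> ('b \<Rightarrow> 'n::ab_group_add \<Rightarrow> 'n) \<Rightarrow>
      (('m \<times> 'n) multiset \<times> ('m \<times> 'n) multiset) set"
  where "tensor ract lact = additive_congruence (
      {({#(m + m', n)#}, {#(m, n), (m', n)#}) |m m' n. True} \<union>
      {({#(m, n + n')#}, {#(m, n), (m, n')#}) |m n n'. True} \<union>
      {({#(0, n)#}, {#}) |n. True} \<union>
      {({#(m, 0)#}, {#}) |m. True} \<union>
      {({#(ract m b, n)#}, {#(m, lact b n)#}) |m b n. True})"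

text \<open>
  The iterated tensor product \<open>M \<otimes>\<^sub>B N \<otimes>\<^sub>C P\<close>, generated by triples: both bracketings
  are identified with it.  Here \<open>ract1\<close> is the action of \<open>B\<close> on \<open>M\<close>, \<open>lact1\<close> and \<open>ract2\<close> are the
  actions of \<open>B\<close> and \<open>C\<close> on \<open>N\<close>, and \<open>lact2\<close> is the action of \<open>C\<close> on \<open>P\<close>.
\<close>

definition tensor3 ::
    "('m::ab_group_add \<Rightarrow> 'b \<Rightarrow> 'm) \<Rightarrow> ('b \<Rightarrow> 'n::ab_group_add \<Rightarrow> 'n) \<Rightarrow>
      ('n \<Rightarrow> 'c \<Rightarrow> 'n) \<Rightarrow> ('c \<Rightarrow> 'p::ab_group_add \<Rightarrow> 'p) \<Rightarrow>
      (('m \<times> 'n \<times> 'p) multiset \<times> ('m \<times> 'n \<times> 'p) multiset) set"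
  where "tensor3 ract1 lact1 ract2 lact2 = additive_congruence (
      {({#(m + m', n, p)#}, {#(m, n, p), (m', n, p)#}) |m m' n p. True} \<union>
      {({#(m, n + n', p)#}, {#(m, n, p), (m, n', p)#}) |m n n' p. True} \<union>
      {({#(m, n, p + p')#}, {#(m, n, p), (m, n, p')#}) |m n p p'. True} \<union>
      {({#(0, n, p)#}, {#}) |n p. True} \<union>
      {({#(m, 0, p)#}, {#}) |m p. True} \<union>
      {({#(m, n, 0)#}, {#}) |m n. True} \<union>
      {({#(ract1 m b, n, p)#}, {#(m, lact1 b n, p)#}) |m b n p. True} \<union>
      {({#(m, ract2 n c, p)#}, {#(m, n, lact2 c p)#}) |m n c p. True})"

definition representative :: "'x set \<Rightarrow> 'x"
  where "representative X = (SOME x. x \<in> X)"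

text \<open>
  Sweedler notation: for \<open>X = \<Sum>\<^sub>i x\<^sub>i \<otimes> y\<^sub>i\<close>, \<open>sweedler X f\<close> is \<open>\<Sum>\<^sub>i f x\<^sub>i y\<^sub>i\<close>.  As usual this is
  meaningful only if the sum (or, for formal sums, its class) does not depend on the representative;
  see \<open>sweedler_tensor\<close> and \<open>sweedler_tensor_class\<close> below.
\<close>

definition sweedler ::
    "('m \<times> 'n) multiset set \<Rightarrow> ('m \<Rightarrow> 'n \<Rightarrow> 'g::comm_monoid_add) \<Rightarrow> 'g"
  where "sweedler X f = (\<Sum>(x, y) \<in># representative X. f x y)"

definition tensor_add ::
    "('x multiset \<times> 'x multiset) set \<Rightarrow> 'x multiset set \<Rightarrow> 'x multiset set \<Rightarrow> 'x multiset set"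
  where "tensor_add T X Y = T `` {representative X + representative Y}"

definition tensor_lact ::
    "(('m \<times> 'n) multiset \<times> ('m \<times> 'n) multiset) set \<Rightarrow> ('b \<Rightarrow> 'm \<Rightarrow> 'm) \<Rightarrow>
      'b \<Rightarrow> ('m \<times> 'n) multiset set \<Rightarrow> ('m \<times> 'n) multiset set"
  where "tensor_lact T lact b X = T `` {sweedler X (\<lambda>m n. {#(lact b m, n)#})}"

definition tensor_ract ::
    "(('m \<times> 'n) multiset \<times> ('m \<times> 'n) multiset) set \<Rightarrow> ('n \<Rightarrow> 'b \<Rightarrow> 'n) \<Rightarrow>
      ('m \<times> 'n) multiset set \<Rightarrow> 'b \<Rightarrow> ('m \<times> 'n) multiset set"
  where "tensor_ract T ract X b = T `` {sweedler X (\<lambda>m n. {#(m, ract n b)#})}"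

lemma equiv_additive_congruence: "equiv UNIV (additive_congruence E)"
  by (rule equivI) (auto intro: refl_onI symI transI additive_congruence.intros)

lemma equiv_tensor: "equiv UNIV (tensor ract lact)"
  unfolding tensor_def by (rule equiv_additive_congruence)

lemma equiv_tensor3: "equiv UNIV (tensor3 ract1 lact1 ract2 lact2)"
  unfolding tensor3_def by (rule equiv_additive_congruence)

lemma sweedler_tensor:
  fixes f :: "'m::ab_group_add \<Rightarrow> 'n::ab_group_add \<Rightarrow> 'g::ab_group_add"
  assumes add_left: "\<And>m m' n. f (m + m') n = f m n + f m' n"
    and add_right: "\<And>m n n'. f m (n + n') = f m n + f m n'"
    and balanced: "\<And>m b n. f (ract m b) n = f m (lact b n)"
  shows "sweedler (tensor ract lact `` {x}) f = (\<Sum>(m, n) \<in># x. f m n)"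
proof -
  have zero: "f 0 n = 0" "f m 0 = 0" for m n
    using add_left[of 0 0 n] add_right[of m 0 0] by simp_all
  have "(\<Sum>(m, n) \<in># u. f m n) = (\<Sum>(m, n) \<in># v. f m n)" if "(u, v) \<in> tensor ract lact" for u v
    using that unfolding tensor_def
    by (induction rule: additive_congruence.induct)
      (auto simp: add_left add_right balanced zero)
  moreover have "representative (tensor ract lact `` {x}) \<in> tensor ract lact `` {x}"
    unfolding representative_def
    by (rule someI[of _ x]) (simp add: tensor_def additive_congruence.refl)
  ultimately show ?thesis
    by (auto simp: sweedler_def)
qed

lemma sweedler_tensor_class:
  assumes T': "T' = additive_congruence E"
    and add_left: "\<And>m m' n. (f (m + m') n, f m n + f m' n) \<in> T'"
    and add_right: "\<And>m n n'. (f m (n + n'), f m n + f m n') \<in> T'"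
    and zero_left: "\<And>n. (f 0 n, {#}) \<in> T'"
    and zero_right: "\<And>m. (f m 0, {#}) \<in> T'"
    and balanced: "\<And>m b n. (f (ract m b) n, f m (lact b n)) \<in> T'"
  shows "T' `` {sweedler (tensor ract lact `` {x}) f} = T' `` {\<Sum>(m, n) \<in># x. f m n}"
proof -
  have A: "(\<Sum>(m, n) \<in># u. f m n, \<Sum>(m, n) \<in># v. f m n) \<in> T'" if "(u, v) \<in> tensor ract lact" for u v
    using that unfolding tensor_def
  proof (induction rule: additive_congruence.induct)
    case (base x y)
    then show ?case
      using add_left add_right zero_left zero_right balanced by (auto simp: add.commute)
  qed (auto simp: T' intro: additive_congruence.intros)
  have "representative (tensor ract lact `` {x}) \<in> tensor ract lact `` {x}"
    unfolding representative_def
    by (rule someI[of _ x]) (simp add: tensor_def additive_congruence.refl)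
  hence "(\<Sum>(m, n) \<in># x. f m n, sweedler (tensor ract lact `` {x}) f) \<in> T'"
    unfolding sweedler_def by (intro A) simp
  thus ?thesis unfolding T'
    by (metis equiv_additive_congruence equiv_class_eq)
qed

section \<open>Corings and comodules\<close>

locale coring = bimodule scB scC lact ract
  for scB :: "'k::{comm_ring,comm_monoid_mult} \<Rightarrow> 'b::{ring,monoid_mult} \<Rightarrow> 'b"
    and scC :: "'k \<Rightarrow> 'c::ab_group_add \<Rightarrow> 'c"
    and lact :: "'b \<Rightarrow> 'c \<Rightarrow> 'c"
    and ract :: "'c \<Rightarrow> 'b \<Rightarrow> 'c" +
  fixes \<gamma> :: "'c \<Rightarrow> ('c \<times> 'c) multiset set"
    and \<pi> :: "'c \<Rightarrow> 'b"
  assumes comult_in: "\<gamma> x \<in> UNIV // tensor ract lact"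
    and comult_add: "\<gamma> (x + y) = tensor_add (tensor ract lact) (\<gamma> x) (\<gamma> y)"
    and comult_lact: "\<gamma> (lact b x) = tensor_lact (tensor ract lact) lact b (\<gamma> x)"
    and comult_ract: "\<gamma> (ract x b) = tensor_ract (tensor ract lact) ract (\<gamma> x) b"
    and counit_add: "\<pi> (x + y) = \<pi> x + \<pi> y"
    and counit_lact: "\<pi> (lact b x) = b * \<pi> x"
    and counit_ract: "\<pi> (ract x b) = \<pi> x * b"
    and coassoc: "tensor3 ract lact ract lact ``
          {sweedler (\<gamma> x) (\<lambda>x1 x2. sweedler (\<gamma> x1) (\<lambda>x11 x12. {#(x11, x12, x2)#}))} =
        tensor3 ract lact ract lact ``
          {sweedler (\<gamma> x) (\<lambda>x1 x2. sweedler (\<gamma> x2) (\<lambda>x21 x22. {#(x1, x21, x22)#}))}"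
    and counit_left: "sweedler (\<gamma> x) (\<lambda>x1 x2. lact (\<pi> x1) x2) = x"
    and counit_right: "sweedler (\<gamma> x) (\<lambda>x1 x2. ract x1 (\<pi> x2)) = x"

locale right_comodule =
  C: coring scB scC lactC ractC \<gamma> \<pi> + M: right_module scB scM ract
  for scB :: "'k::{comm_ring,comm_monoid_mult} \<Rightarrow> 'b::{ring,monoid_mult} \<Rightarrow> 'b"
    and scC :: "'k \<Rightarrow> 'c::ab_group_add \<Rightarrow> 'c"
    and lactC :: "'b \<Rightarrow> 'c \<Rightarrow> 'c"
    and ractC :: "'c \<Rightarrow> 'b \<Rightarrow> 'c"
    and \<gamma> :: "'c \<Rightarrow> ('c \<times> 'c) multiset set"
    and \<pi> :: "'c \<Rightarrow> 'b"
    and scM :: "'k \<Rightarrow> 'm::ab_group_add \<Rightarrow> 'm"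
    and ract :: "'m \<Rightarrow> 'b \<Rightarrow> 'm" +
  fixes \<tau> :: "'m \<Rightarrow> ('m \<times> 'c) multiset set"
  assumes coact_in: "\<tau> m \<in> UNIV // tensor ract lactC"
    and coact_add: "\<tau> (m + m') = tensor_add (tensor ract lactC) (\<tau> m) (\<tau> m')"
    and coact_ract: "\<tau> (ract m b) = tensor_ract (tensor ract lactC) ractC (\<tau> m) b"
    and coact_coassoc: "tensor3 ract lactC ractC lactC ``
          {sweedler (\<tau> m) (\<lambda>m0 m1. sweedler (\<tau> m0) (\<lambda>m00 m01. {#(m00, m01, m1)#}))} =
        tensor3 ract lactC ractC lactC ``
          {sweedler (\<tau> m) (\<lambda>m0 m1. sweedler (\<gamma> m1) (\<lambda>m11 m12. {#(m0, m11, m12)#}))}"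
    and coact_counit: "sweedler (\<tau> m) (\<lambda>m0 m1. ract m0 (\<pi> m1)) = m"

section \<open>Bialgebroids and Hopf algebroids\<close>

locale left_bialgebroid = L: k_algebra scL + H: k_algebra scH +
    coring scL scH "\<lambda>l h. s l * h" "\<lambda>h l. t l * h" \<gamma> \<pi>
  for scL :: "'k::{comm_ring,comm_monoid_mult} \<Rightarrow> 'l::{ring,monoid_mult} \<Rightarrow> 'l"
    and scH :: "'k \<Rightarrow> 'h::{ring,monoid_mult} \<Rightarrow> 'h"
    and s :: "'l \<Rightarrow> 'h"
    and t :: "'l \<Rightarrow> 'h"
    and \<gamma> :: "'h \<Rightarrow> ('h \<times> 'h) multiset set"
    and \<pi> :: "'h \<Rightarrow> 'l" +
  assumes source: "algebra_map scL scH s"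
    and target: "algebra_op_map scL scH t"
    and source_target_commute: "s l * t l' = t l' * s l"
    and takeuchi: "tensor (\<lambda>h l. t l * h) (\<lambda>l h. s l * h) ``
          {sweedler (\<gamma> h) (\<lambda>h1 h2. {#(h1 * t l, h2)#})} =
        tensor (\<lambda>h l. t l * h) (\<lambda>l h. s l * h) ``
          {sweedler (\<gamma> h) (\<lambda>h1 h2. {#(h1, h2 * s l)#})}"
    and comult_one: "\<gamma> 1 = tensor (\<lambda>h l. t l * h) (\<lambda>l h. s l * h) `` {{#(1, 1)#}}"
    and comult_mult: "\<gamma> (h * h') = tensor (\<lambda>h l. t l * h) (\<lambda>l h. s l * h) ``
          {sweedler (\<gamma> h) (\<lambda>h1 h2. sweedler (\<gamma> h') (\<lambda>h1' h2'. {#(h1 * h1', h2 * h2')#}))}"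
    and counit_one: "\<pi> 1 = 1"
    and counit_source: "\<pi> (h * s (\<pi> h')) = \<pi> (h * h')"
    and counit_target: "\<pi> (h * t (\<pi> h')) = \<pi> (h * h')"

locale right_bialgebroid = R: k_algebra scR + H: k_algebra scH +
    coring scR scH "\<lambda>r h. h * t r" "\<lambda>h r. h * s r" \<gamma> \<pi>
  for scR :: "'k::{comm_ring,comm_monoid_mult} \<Rightarrow> 'r::{ring,monoid_mult} \<Rightarrow> 'r"
    and scH :: "'k \<Rightarrow> 'h::{ring,monoid_mult} \<Rightarrow> 'h"
    and s :: "'r \<Rightarrow> 'h"
    and t :: "'r \<Rightarrow> 'h"
    and \<gamma> :: "'h \<Rightarrow> ('h \<times> 'h) multiset set"
    and \<pi> :: "'h \<Rightarrow> 'r" +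
  assumes source: "algebra_map scR scH s"
    and target: "algebra_op_map scR scH t"
    and source_target_commute: "s r * t r' = t r' * s r"
    and takeuchi: "tensor (\<lambda>h r. h * s r) (\<lambda>r h. h * t r) ``
          {sweedler (\<gamma> h) (\<lambda>h1 h2. {#(s r * h1, h2)#})} =
        tensor (\<lambda>h r. h * s r) (\<lambda>r h. h * t r) ``
          {sweedler (\<gamma> h) (\<lambda>h1 h2. {#(h1, t r * h2)#})}"
    and comult_one: "\<gamma> 1 = tensor (\<lambda>h r. h * s r) (\<lambda>r h. h * t r) `` {{#(1, 1)#}}"
    and comult_mult: "\<gamma> (h * h') = tensor (\<lambda>h r. h * s r) (\<lambda>r h. h * t r) ``
          {sweedler (\<gamma> h) (\<lambda>h1 h2. sweedler (\<gamma> h') (\<lambda>h1' h2'. {#(h1 * h1', h2 * h2')#}))}"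
    and counit_one: "\<pi> 1 = 1"
    and counit_source: "\<pi> (s (\<pi> h) * h') = \<pi> (h * h')"
    and counit_target: "\<pi> (t (\<pi> h) * h') = \<pi> (h * h')"

locale hopf_algebroid =
  L: left_bialgebroid scL scH sL tL \<gamma>L \<pi>L + R: right_bialgebroid scR scH sR tR \<gamma>R \<pi>R
  for scL :: "'k::{comm_ring,comm_monoid_mult} \<Rightarrow> 'l::{ring,monoid_mult} \<Rightarrow> 'l"
    and scR :: "'k \<Rightarrow> 'r::{ring,monoid_mult} \<Rightarrow> 'r"
    and scH :: "'k \<Rightarrow> 'h::{ring,monoid_mult} \<Rightarrow> 'h"
    and sL :: "'l \<Rightarrow> 'h" and tL :: "'l \<Rightarrow> 'h"
    and \<gamma>L :: "'h \<Rightarrow> ('h \<times> 'h) multiset set" and \<pi>L :: "'h \<Rightarrow> 'l"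
    and sR :: "'r \<Rightarrow> 'h" and tR :: "'r \<Rightarrow> 'h"
    and \<gamma>R :: "'h \<Rightarrow> ('h \<times> 'h) multiset set" and \<pi>R :: "'h \<Rightarrow> 'r" +
  fixes S :: "'h \<Rightarrow> 'h"
  assumes S_linear: "k_linear scH scH S"
    and sL_piL_tR: "sL (\<pi>L (tR r)) = tR r"
    and tL_piL_sR: "tL (\<pi>L (sR r)) = sR r"
    and sR_piR_tL: "sR (\<pi>R (tL l)) = tL l"
    and tR_piR_sL: "tR (\<pi>R (sL l)) = sL l"
    and mixed_coassoc_LR:
      "tensor3 (\<lambda>h l. tL l * h) (\<lambda>l h. sL l * h) (\<lambda>h r. h * sR r) (\<lambda>r h. h * tR r) ``
          {sweedler (\<gamma>R h) (\<lambda>h1 h2. sweedler (\<gamma>L h1) (\<lambda>h11 h12. {#(h11, h12, h2)#}))} =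
        tensor3 (\<lambda>h l. tL l * h) (\<lambda>l h. sL l * h) (\<lambda>h r. h * sR r) (\<lambda>r h. h * tR r) ``
          {sweedler (\<gamma>L h) (\<lambda>h1 h2. sweedler (\<gamma>R h2) (\<lambda>h21 h22. {#(h1, h21, h22)#}))}"
    and mixed_coassoc_RL:
      "tensor3 (\<lambda>h r. h * sR r) (\<lambda>r h. h * tR r) (\<lambda>h l. tL l * h) (\<lambda>l h. sL l * h) ``
          {sweedler (\<gamma>L h) (\<lambda>h1 h2. sweedler (\<gamma>R h1) (\<lambda>h11 h12. {#(h11, h12, h2)#}))} =
        tensor3 (\<lambda>h r. h * sR r) (\<lambda>r h. h * tR r) (\<lambda>h l. tL l * h) (\<lambda>l h. sL l * h) ``
          {sweedler (\<gamma>R h) (\<lambda>h1 h2. sweedler (\<gamma>L h2) (\<lambda>h21 h22. {#(h1, h21, h22)#}))}"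
    and S_tL: "S (tL l * h * tL l') = sL l' * S h * sL l"
    and S_tR: "S (tR r * h * tR r') = sR r' * S h * sR r"
    and antipode_left: "sweedler (\<gamma>L h) (\<lambda>h1 h2. S h1 * h2) = sR (\<pi>R h)"
    and antipode_right: "sweedler (\<gamma>R h) (\<lambda>h1 h2. h1 * S h2) = sL (\<pi>L h)"

section \<open>Comodules and comodule algebras\<close>

text \<open>Left actions on right comodules of left and right bialgebroids.\<close>

definition comodule_lact_L ::
    "('l \<Rightarrow> 'h::{ring,monoid_mult}) \<Rightarrow> ('h \<Rightarrow> 'l) \<Rightarrow> ('m::ab_group_add \<Rightarrow> 'l \<Rightarrow> 'm) \<Rightarrow>
      ('m \<Rightarrow> ('m \<times> 'h) multiset set) \<Rightarrow> 'l \<Rightarrow> 'm \<Rightarrow> 'm"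
  where "comodule_lact_L s \<pi> ract \<tau> l m = sweedler (\<tau> m) (\<lambda>m0 m1. ract m0 (\<pi> (m1 * s l)))"

definition comodule_lact_R ::
    "('r \<Rightarrow> 'h::{ring,monoid_mult}) \<Rightarrow> ('h \<Rightarrow> 'r) \<Rightarrow> ('m::ab_group_add \<Rightarrow> 'r \<Rightarrow> 'm) \<Rightarrow>
      ('m \<Rightarrow> ('m \<times> 'h) multiset set) \<Rightarrow> 'r \<Rightarrow> 'm \<Rightarrow> 'm"
  where "comodule_lact_R s \<pi> ract \<tau> r m = sweedler (\<tau> m) (\<lambda>m0 m1. ract m0 (\<pi> (s r * m1)))"

locale left_bialgebroid_comodule =
  H: left_bialgebroid scL scH s t \<gamma> \<pi> +
  right_comodule scL scH "\<lambda>l h. s l * h" "\<lambda>h l. t l * h" \<gamma> \<pi> scM ract \<tau> +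
  bimodule scL scM "comodule_lact_L s \<pi> ract \<tau>" ract
  for scL :: "'k::{comm_ring,comm_monoid_mult} \<Rightarrow> 'l::{ring,monoid_mult} \<Rightarrow> 'l"
    and scH :: "'k \<Rightarrow> 'h::{ring,monoid_mult} \<Rightarrow> 'h"
    and s :: "'l \<Rightarrow> 'h" and t :: "'l \<Rightarrow> 'h"
    and \<gamma> :: "'h \<Rightarrow> ('h \<times> 'h) multiset set" and \<pi> :: "'h \<Rightarrow> 'l"
    and scM :: "'k \<Rightarrow> 'm::ab_group_add \<Rightarrow> 'm"
    and ract :: "'m \<Rightarrow> 'l \<Rightarrow> 'm"
    and \<tau> :: "'m \<Rightarrow> ('m \<times> 'h) multiset set" +
  assumes coact_takeuchi: "tensor ract (\<lambda>l h. s l * h) ``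
          {sweedler (\<tau> m) (\<lambda>m0 m1. {#(comodule_lact_L s \<pi> ract \<tau> l m0, m1)#})} =
        tensor ract (\<lambda>l h. s l * h) `` {sweedler (\<tau> m) (\<lambda>m0 m1. {#(m0, m1 * s l)#})}"

locale right_bialgebroid_comodule =
  H: right_bialgebroid scR scH s t \<gamma> \<pi> +
  right_comodule scR scH "\<lambda>r h. h * t r" "\<lambda>h r. h * s r" \<gamma> \<pi> scM ract \<tau> +
  bimodule scR scM "comodule_lact_R s \<pi> ract \<tau>" ract
  for scR :: "'k::{comm_ring,comm_monoid_mult} \<Rightarrow> 'r::{ring,monoid_mult} \<Rightarrow> 'r"
    and scH :: "'k \<Rightarrow> 'h::{ring,monoid_mult} \<Rightarrow> 'h"
    and s :: "'r \<Rightarrow> 'h" and t :: "'r \<Rightarrow> 'h"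
    and \<gamma> :: "'h \<Rightarrow> ('h \<times> 'h) multiset set" and \<pi> :: "'h \<Rightarrow> 'r"
    and scM :: "'k \<Rightarrow> 'm::ab_group_add \<Rightarrow> 'm"
    and ract :: "'m \<Rightarrow> 'r \<Rightarrow> 'm"
    and \<tau> :: "'m \<Rightarrow> ('m \<times> 'h) multiset set" +
  assumes coact_takeuchi: "tensor ract (\<lambda>r h. h * t r) ``
          {sweedler (\<tau> m) (\<lambda>m0 m1. {#(comodule_lact_R s \<pi> ract \<tau> r m0, m1)#})} =
        tensor ract (\<lambda>r h. h * t r) `` {sweedler (\<tau> m) (\<lambda>m0 m1. {#(m0, t r * m1)#})}"

locale left_bialgebroid_comodule_algebra =
  left_bialgebroid_comodule scL scH s t \<gamma> \<pi> scA ract \<tau> + A: k_algebra scA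
  for scL :: "'k::{comm_ring,comm_monoid_mult} \<Rightarrow> 'l::{ring,monoid_mult} \<Rightarrow> 'l"
    and scH :: "'k \<Rightarrow> 'h::{ring,monoid_mult} \<Rightarrow> 'h"
    and s :: "'l \<Rightarrow> 'h" and t :: "'l \<Rightarrow> 'h"
    and \<gamma> :: "'h \<Rightarrow> ('h \<times> 'h) multiset set" and \<pi> :: "'h \<Rightarrow> 'l"
    and scA :: "'k \<Rightarrow> 'a::{ring,monoid_mult} \<Rightarrow> 'a"
    and ract :: "'a \<Rightarrow> 'l \<Rightarrow> 'a"
    and \<tau> :: "'a \<Rightarrow> ('a \<times> 'h) multiset set" +
  assumes op_ring_ract: "ract a l = ract 1 l * a"
    and op_ring_lact: "comodule_lact_L s \<pi> ract \<tau> l a = a * ract 1 l"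
    and op_ring_unit: "comodule_lact_L s \<pi> ract \<tau> l 1 = ract 1 l"
    and coact_one: "\<tau> 1 = tensor ract (\<lambda>l h. s l * h) `` {{#(1, 1)#}}"
    and coact_mult: "\<tau> (a * a') = tensor ract (\<lambda>l h. s l * h) ``
          {sweedler (\<tau> a) (\<lambda>a0 a1. sweedler (\<tau> a') (\<lambda>a0' a1'. {#(a0 * a0', a1 * a1')#}))}"

text \<open>The first three assumptions say that the product of \<open>A\<close> is an \<open>R\<close>-balanced bimodule map; with
  the unit \<open>r \<mapsto> r \<cdot> 1\<close>, this makes \<open>A\<close> an \<open>R\<close>-ring.\<close>

locale right_bialgebroid_comodule_algebra =
  right_bialgebroid_comodule scR scH s t \<gamma> \<pi> scA ract \<tau> + A: k_algebra scA
  for scR :: "'k::{comm_ring,comm_monoid_mult} \<Rightarrow> 'r::{ring,monoid_mult} \<Rightarrow> 'r"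
    and scH :: "'k \<Rightarrow> 'h::{ring,monoid_mult} \<Rightarrow> 'h"
    and s :: "'r \<Rightarrow> 'h" and t :: "'r \<Rightarrow> 'h"
    and \<gamma> :: "'h \<Rightarrow> ('h \<times> 'h) multiset set" and \<pi> :: "'h \<Rightarrow> 'r"
    and scA :: "'k \<Rightarrow> 'a::{ring,monoid_mult} \<Rightarrow> 'a"
    and ract :: "'a \<Rightarrow> 'r \<Rightarrow> 'a"
    and \<tau> :: "'a \<Rightarrow> ('a \<times> 'h) multiset set" +
  assumes ring_lact: "comodule_lact_R s \<pi> ract \<tau> r (a * a') = comodule_lact_R s \<pi> ract \<tau> r a * a'"
    and ring_ract: "ract (a * a') r = a * ract a' r"
    and ring_balanced: "ract a r * a' = a * comodule_lact_R s \<pi> ract \<tau> r a'"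
    and coact_one: "\<tau> 1 = tensor ract (\<lambda>r h. h * t r) `` {{#(1, 1)#}}"
    and coact_mult: "\<tau> (a * a') = tensor ract (\<lambda>r h. h * t r) ``
          {sweedler (\<tau> a) (\<lambda>a0 a1. sweedler (\<tau> a') (\<lambda>a0' a1'. {#(a0 * a0', a1 * a1')#}))}"

locale hopf_comodule =
  H: hopf_algebroid scL scR scH sL tL \<gamma>L \<pi>L sR tR \<gamma>R \<pi>R S +
  L: left_bialgebroid_comodule scL scH sL tL \<gamma>L \<pi>L scM ractL \<tau>L +
  R: right_bialgebroid_comodule scR scH sR tR \<gamma>R \<pi>R scM ractR \<tau>R
  for scL :: "'k::{comm_ring,comm_monoid_mult} \<Rightarrow> 'l::{ring,monoid_mult} \<Rightarrow> 'l"
    and scR :: "'k \<Rightarrow> 'r::{ring,monoid_mult} \<Rightarrow> 'r"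
    and scH :: "'k \<Rightarrow> 'h::{ring,monoid_mult} \<Rightarrow> 'h"
    and sL :: "'l \<Rightarrow> 'h" and tL :: "'l \<Rightarrow> 'h"
    and \<gamma>L :: "'h \<Rightarrow> ('h \<times> 'h) multiset set" and \<pi>L :: "'h \<Rightarrow> 'l"
    and sR :: "'r \<Rightarrow> 'h" and tR :: "'r \<Rightarrow> 'h"
    and \<gamma>R :: "'h \<Rightarrow> ('h \<times> 'h) multiset set" and \<pi>R :: "'h \<Rightarrow> 'r"
    and S :: "'h \<Rightarrow> 'h"
    and scM :: "'k \<Rightarrow> 'm::ab_group_add \<Rightarrow> 'm"
    and ractL :: "'m \<Rightarrow> 'l \<Rightarrow> 'm" and ractR :: "'m \<Rightarrow> 'r \<Rightarrow> 'm"
    and \<tau>L :: "'m \<Rightarrow> ('m \<times> 'h) multiset set" and \<tau>R :: "'m \<Rightarrow> ('m \<times> 'h) multiset set" +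
  assumes actions_agree:
      "ractL (comodule_lact_L sL \<pi>L ractL \<tau>L l m) l' =
        ractR (comodule_lact_R sR \<pi>R ractR \<tau>R (\<pi>R (tL l')) m) (\<pi>R (tL l))"
    and coact_mixed_RL:
      "tensor3 ractR (\<lambda>r h. h * tR r) (\<lambda>h l. tL l * h) (\<lambda>l h. sL l * h) ``
          {sweedler (\<tau>L m) (\<lambda>m0 m1. sweedler (\<tau>R m0) (\<lambda>m00 m01. {#(m00, m01, m1)#}))} =
        tensor3 ractR (\<lambda>r h. h * tR r) (\<lambda>h l. tL l * h) (\<lambda>l h. sL l * h) ``
          {sweedler (\<tau>R m) (\<lambda>m0 m1. sweedler (\<gamma>L m1) (\<lambda>m11 m12. {#(m0, m11, m12)#}))}"
    and coact_mixed_LR: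
      "tensor3 ractL (\<lambda>l h. sL l * h) (\<lambda>h r. h * sR r) (\<lambda>r h. h * tR r) ``
          {sweedler (\<tau>R m) (\<lambda>m0 m1. sweedler (\<tau>L m0) (\<lambda>m00 m01. {#(m00, m01, m1)#}))} =
        tensor3 ractL (\<lambda>l h. sL l * h) (\<lambda>h r. h * sR r) (\<lambda>r h. h * tR r) ``
          {sweedler (\<tau>L m) (\<lambda>m0 m1. sweedler (\<gamma>R m1) (\<lambda>m11 m12. {#(m0, m11, m12)#}))}"

locale hopf_comodule_algebra =
  hopf_comodule scL scR scH sL tL \<gamma>L \<pi>L sR tR \<gamma>R \<pi>R S scA ractL ractR \<tau>L \<tau>R +
  LA: left_bialgebroid_comodule_algebra scL scH sL tL \<gamma>L \<pi>L scA ractL \<tau>L +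
  RA: right_bialgebroid_comodule_algebra scR scH sR tR \<gamma>R \<pi>R scA ractR \<tau>R
  for scL :: "'k::{comm_ring,comm_monoid_mult} \<Rightarrow> 'l::{ring,monoid_mult} \<Rightarrow> 'l"
    and scR :: "'k \<Rightarrow> 'r::{ring,monoid_mult} \<Rightarrow> 'r"
    and scH :: "'k \<Rightarrow> 'h::{ring,monoid_mult} \<Rightarrow> 'h"
    and sL :: "'l \<Rightarrow> 'h" and tL :: "'l \<Rightarrow> 'h"
    and \<gamma>L :: "'h \<Rightarrow> ('h \<times> 'h) multiset set" and \<pi>L :: "'h \<Rightarrow> 'l"
    and sR :: "'r \<Rightarrow> 'h" and tR :: "'r \<Rightarrow> 'h"
    and \<gamma>R :: "'h \<Rightarrow> ('h \<times> 'h) multiset set" and \<pi>R :: "'h \<Rightarrow> 'r"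
    and S :: "'h \<Rightarrow> 'h"
    and scA :: "'k \<Rightarrow> 'a::{ring,monoid_mult} \<Rightarrow> 'a"
    and ractL :: "'a \<Rightarrow> 'l \<Rightarrow> 'a" and ractR :: "'a \<Rightarrow> 'r \<Rightarrow> 'a"
    and \<tau>L :: "'a \<Rightarrow> ('a \<times> 'h) multiset set" and \<tau>R :: "'a \<Rightarrow> ('a \<times> 'h) multiset set"

section \<open>The map \<open>\<psi>\<close>\<close>

definition bimodule_isomorphism ::
    "'x set \<Rightarrow> ('x \<Rightarrow> 'x \<Rightarrow> 'x) \<Rightarrow> ('b \<Rightarrow> 'x \<Rightarrow> 'x) \<Rightarrow> ('x \<Rightarrow> 'b \<Rightarrow> 'x) \<Rightarrow>
      'y set \<Rightarrow> ('y \<Rightarrow> 'y \<Rightarrow> 'y) \<Rightarrow> ('b \<Rightarrow> 'y \<Rightarrow> 'y) \<Rightarrow> ('y \<Rightarrow> 'b \<Rightarrow> 'y) \<Rightarrow> ('x \<Rightarrow> 'y) \<Rightarrow> bool"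
  where "bimodule_isomorphism M addM lactM ractM N addN lactN ractN f \<longleftrightarrow>
    bij_betw f M N \<and>
    (\<forall>x\<in>M. \<forall>y\<in>M. f (addM x y) = addN (f x) (f y)) \<and>
    (\<forall>b. \<forall>x\<in>M. f (lactM b x) = lactN b (f x)) \<and>
    (\<forall>b. \<forall>x\<in>M. f (ractM x b) = ractN (f x) b)"

text \<open>\<open>AH\<close> is the congruence defining \<open>A \<otimes>\<^sub>R H\<close>.\<close>

definition psi ::
    "(('a \<times> 'h) multiset \<times> ('a \<times> 'h) multiset) set \<Rightarrow> ('a \<Rightarrow> ('a \<times> 'h::{ring,monoid_mult}) multiset set) \<Rightarrow>
      ('h \<times> 'a) multiset set \<Rightarrow> ('a \<times> 'h) multiset set"
  where "psi AH \<tau> X =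
    AH `` {sweedler X (\<lambda>h a. sweedler (\<tau> a) (\<lambda>a0 a1. {#(a0, h * a1)#}))}"

end

(* The inverse of psi is a (x) h |-> h S^{-1}(a_<1>) (x) a_<0>, where a_<0> (x) a_<1> is the
   H_L-coaction.  By the mixed coassociativity of the two coactions, the two composites reduce to
   S^{-1}(h_(2)) h_(1) = t_R(pi_R(h)) and h^(2) S^{-1}(h^(1)) = t_L(pi_L(h)), the antipode axioms
   transformed by S^{-1}; this uses that S is anti-multiplicative, which is not an axiom.  To see it,
   evaluate S(h'_(1)) S(h_(1)) h_(2)^(1) h'_(2)^(1) S(h_(2)^(2) h'_(2)^(2)) in two ways: contracting
   the right-hand factors gives S(h') S(h), and after exchanging gamma_L and gamma_R, contracting
   the left-hand factors gives S(h h'). *)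

theory Submission
  imports Defs
begin

section \<open>Evaluating balanced maps on formal sums\<close>

text \<open>Working modulo an additive congruence \<open>T\<close> treats maps into a group (\<open>T = Id\<close>) and maps into
  formal sums that are only well defined in a tensor product (\<open>T = tensor \<dots>\<close>) uniformly.\<close>

definition add_congruence :: "('g::comm_monoid_add \<times> 'g) set \<Rightarrow> bool"
  where "add_congruence T \<longleftrightarrow> equiv UNIV T \<and>
    (\<forall>x y u v. (x, y) \<in> T \<longrightarrow> (u, v) \<in> T \<longrightarrow> (x + u, y + v) \<in> T)"

text \<open>In a commutative monoid without cancellation, additivity modulo \<open>T\<close> does
  not yield the two zero conditions, so they are listed separately.\<close>

definition biadditive ::
    "('g::comm_monoid_add \<times> 'g) set \<Rightarrow> ('m::ab_group_add \<Rightarrow> 'n::ab_group_add \<Rightarrow> 'g) \<Rightarrow> bool"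
  where "biadditive T f \<longleftrightarrow>
    (\<forall>m m' n. (f (m + m') n, f m n + f m' n) \<in> T) \<and>
    (\<forall>m n n'. (f m (n + n'), f m n + f m n') \<in> T) \<and>
    (\<forall>n. (f 0 n, 0) \<in> T) \<and> (\<forall>m. (f m 0, 0) \<in> T)"

definition balanced ::
    "('g::comm_monoid_add \<times> 'g) set \<Rightarrow> ('m::ab_group_add \<Rightarrow> 'b \<Rightarrow> 'm) \<Rightarrow>
      ('b \<Rightarrow> 'n::ab_group_add \<Rightarrow> 'n) \<Rightarrow> ('m \<Rightarrow> 'n \<Rightarrow> 'g) \<Rightarrow> bool"
  where "balanced T ract lact f \<longleftrightarrow>
    biadditive T f \<and> (\<forall>m b n. (f (ract m b) n, f m (lact b n)) \<in> T)"

text \<open>Balancedness in each of the two adjacent pairs of arguments covers all generators of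
  \<open>tensor3\<close>.\<close>

definition balanced3 ::
    "('g::comm_monoid_add \<times> 'g) set \<Rightarrow> ('m::ab_group_add \<Rightarrow> 'b \<Rightarrow> 'm) \<Rightarrow>
      ('b \<Rightarrow> 'n::ab_group_add \<Rightarrow> 'n) \<Rightarrow> ('n \<Rightarrow> 'c \<Rightarrow> 'n) \<Rightarrow>
      ('c \<Rightarrow> 'p::ab_group_add \<Rightarrow> 'p) \<Rightarrow> ('m \<Rightarrow> 'n \<Rightarrow> 'p \<Rightarrow> 'g) \<Rightarrow> bool"
  where "balanced3 T ract1 lact1 ract2 lact2 f \<longleftrightarrow>
    (\<forall>p. balanced T ract1 lact1 (\<lambda>m n. f m n p)) \<and>
    (\<forall>m. balanced T ract2 lact2 (f m))"

lemma add_congruence_Id: "add_congruence Id"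
  by (auto simp: add_congruence_def equiv_def refl_on_def sym_def trans_def)

lemma add_congruence_tensor: "add_congruence (tensor ract lact)"
  using equiv_tensor[of ract lact] unfolding add_congruence_def
  by (auto simp: tensor_def intro: additive_congruence.add)

lemma
  assumes "add_congruence T"
  shows add_congruence_refl: "(x, x) \<in> T"
    and add_congruence_sym: "(x, y) \<in> T \<Longrightarrow> (y, x) \<in> T"
    and add_congruence_trans: "(x, y) \<in> T \<Longrightarrow> (y, z) \<in> T \<Longrightarrow> (x, z) \<in> T"
    and add_congruence_add: "(x, y) \<in> T \<Longrightarrow> (u, v) \<in> T \<Longrightarrow> (x + u, y + v) \<in> T"
  using assms unfolding add_congruence_def equiv_def
  by (auto dest: refl_onD symD transD)

lemma sum_mset_cong_congruence:
  assumes "add_congruence T" "\<And>x. x \<in># M \<Longrightarrow> (f x, g x) \<in> T"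
  shows "(\<Sum>x\<in>#M. f x, \<Sum>x\<in>#M. g x) \<in> T"
  using assms(2)
  by (induction M) (auto intro: add_congruence_refl[OF assms(1)] add_congruence_add[OF assms(1)])

lemma balanced_Id:
  fixes f :: "'m::ab_group_add \<Rightarrow> 'n::ab_group_add \<Rightarrow> 'g::ab_group_add"
  assumes "\<And>m m' n. f (m + m') n = f m n + f m' n"
    and "\<And>m n n'. f m (n + n') = f m n + f m n'"
    and "\<And>m b n. f (ract m b) n = f m (lact b n)"
  shows "balanced Id ract lact f"
proof -
  have "f 0 n = 0" "f m 0 = 0" for m n
    using assms(1)[of 0 0 n] assms(2)[of m 0 0] by simp_all
  with assms show ?thesis by (simp add: balanced_def biadditive_def)
qed

text \<open>The universal property of the tensor product on formal sums: a balanced map respects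
  every generator, and \<open>T\<close> is closed under all rules that generate the
  congruence.\<close>

lemma balanced_sum:
  assumes T: "add_congruence T" and f: "balanced T ract lact f"
    and "(u, v) \<in> tensor ract lact"
  shows "(\<Sum>(m, n)\<in>#u. f m n, \<Sum>(m, n)\<in>#v. f m n) \<in> T"
  using assms(3) unfolding tensor_def
proof (induction rule: additive_congruence.induct)
  case (base x y)
  then show ?case using f by (auto simp: balanced_def biadditive_def)
qed (auto intro: add_congruence_refl[OF T] add_congruence_sym[OF T] add_congruence_trans[OF T]
      add_congruence_add[OF T])

lemma balanced3_sum:
  assumes T: "add_congruence T" and f: "balanced3 T ract1 lact1 ract2 lact2 f"
    and "(u, v) \<in> tensor3 ract1 lact1 ract2 lact2"
  shows "(\<Sum>(m, n, p)\<in>#u. f m n p, \<Sum>(m, n, p)\<in>#v. f m n p) \<in> T"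
  using assms(3) unfolding tensor3_def
proof (induction rule: additive_congruence.induct)
  case (base x y)
  then show ?case using f by (auto simp: balanced3_def balanced_def biadditive_def)
qed (auto intro: add_congruence_refl[OF T] add_congruence_sym[OF T] add_congruence_trans[OF T]
      add_congruence_add[OF T])

section \<open>Relations in a tensor product and biadditive maps into it\<close>

lemma tensor_basic:
  shows tensor_add_left: "({#(m + m', n)#}, {#(m, n)#} + {#(m', n)#}) \<in> tensor ract lact"
    and tensor_add_right: "({#(m, n + n')#}, {#(m, n)#} + {#(m, n')#}) \<in> tensor ract lact"
    and tensor_zero_left: "({#(0, n)#}, {#}) \<in> tensor ract lact"
    and tensor_zero_right: "({#(m, 0)#}, {#}) \<in> tensor ract lact"
    and tensor_balanced: "({#(ract m b, n)#}, {#(m, lact b n)#}) \<in> tensor ract lact"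
  unfolding tensor_def by (rule additive_congruence.base; force simp: add.commute)+

lemma biadditive_single: "biadditive (tensor ract lact) (\<lambda>m n. {#(m, n)#})"
  unfolding biadditive_def by (intro conjI allI tensor_basic)

lemma biadditive_comp:
  fixes p :: "'a::ab_group_add \<Rightarrow> 'm::ab_group_add" and q :: "'b::ab_group_add \<Rightarrow> 'n::ab_group_add"
  assumes "biadditive T f" "\<And>x y. p (x + y) = p x + p y" "\<And>x y. q (x + y) = q x + q y"
  shows "biadditive T (\<lambda>x y. f (p x) (q y))"
proof -
  have "p 0 = 0" "q 0 = 0" using assms(2)[of 0 0] assms(3)[of 0 0] by simp_all
  then show ?thesis using assms by (simp add: biadditive_def)
qed

lemma biadditive_swap: "biadditive T f \<Longrightarrow> biadditive T (\<lambda>x y. f y x)"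
  by (simp add: biadditive_def)

lemma biadditive_tensor_left:
  fixes p :: "'a::ab_group_add \<Rightarrow> 'b::ab_group_add \<Rightarrow> 'm::ab_group_add"
  assumes "\<And>x x' y. p (x + x') y = p x y + p x' y" "\<And>x y y'. p x (y + y') = p x y + p x y'"
  shows "biadditive (tensor ract lact) (\<lambda>x y. {#(p x y, n)#})"
proof -
  have "p 0 y = 0" "p x 0 = 0" for x y
    using assms(1)[of 0 0 y] assms(2)[of x 0 0] by simp_all
  then show ?thesis
    unfolding biadditive_def assms by (simp only: tensor_basic simp_thms)
qed

lemma biadditive_tensor_right:
  fixes p :: "'a::ab_group_add \<Rightarrow> 'b::ab_group_add \<Rightarrow> 'n::ab_group_add"
  assumes "\<And>x x' y. p (x + x') y = p x y + p x' y" "\<And>x y y'. p x (y + y') = p x y + p x y'"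
  shows "biadditive (tensor ract lact) (\<lambda>x y. {#(m, p x y)#})"
proof -
  have "p 0 y = 0" "p x 0 = 0" for x y
    using assms(1)[of 0 0 y] assms(2)[of x 0 0] by simp_all
  then show ?thesis
    unfolding biadditive_def assms by (simp only: tensor_basic simp_thms)
qed

lemma tensor_sum_left:
  "({#(\<Sum>x\<in>#M. f x, n)#}, \<Sum>x\<in>#M. {#(f x, n)#}) \<in> tensor ract lact"
  supply [trans] = add_congruence_trans[OF add_congruence_tensor]
proof (induction M)
  case (add x M)
  have "({#(f x + (\<Sum>x\<in>#M. f x), n)#}, {#(f x, n)#} + {#(\<Sum>x\<in>#M. f x, n)#}) \<in> tensor ract lact"
    by (rule tensor_add_left)
  also
  have "({#(f x, n)#} + {#(\<Sum>x\<in>#M. f x, n)#}, {#(f x, n)#} + (\<Sum>x\<in>#M. {#(f x, n)#})) \<in> tensor ract lact"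
    by (intro add_congruence_add add_congruence_tensor add_congruence_refl add.IH)
  finally show ?case by simp
qed (simp add: tensor_zero_left)

lemma tensor_sum_right:
  "({#(m, \<Sum>x\<in>#M. f x)#}, \<Sum>x\<in>#M. {#(m, f x)#}) \<in> tensor ract lact"
  supply [trans] = add_congruence_trans[OF add_congruence_tensor]
proof (induction M)
  case (add x M)
  have "({#(m, f x + (\<Sum>x\<in>#M. f x))#}, {#(m, f x)#} + {#(m, \<Sum>x\<in>#M. f x)#}) \<in> tensor ract lact"
    by (rule tensor_add_right)
  also
  have "({#(m, f x)#} + {#(m, \<Sum>x\<in>#M. f x)#}, {#(m, f x)#} + (\<Sum>x\<in>#M. {#(m, f x)#})) \<in> tensor ract lact"
    by (intro add_congruence_add add_congruence_tensor add_congruence_refl add.IH)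
  finally show ?case by simp
qed (simp add: tensor_zero_right)

section \<open>Sweedler sums\<close>

lemma representative_in_quotient:
  assumes "equiv UNIV T" "X \<in> UNIV // T"
  shows "T `` {representative X} = X"
proof -
  obtain x where x: "X = T `` {x}" using assms(2) by (auto elim: quotientE)
  have "x \<in> X" using assms(1) x by (auto simp: equiv_def refl_on_def)
  hence "representative X \<in> X" unfolding representative_def by (rule someI)
  then show ?thesis using assms(1) x by (metis Image_singleton_iff equiv_class_eq)
qed

text \<open>\<open>sweedler\<close> evaluates at a chosen representative. The universal property
  makes this choice immaterial modulo \<open>T\<close>, so a given formal sum can be used
  instead.\<close>

lemma sweedler_tensor_congruence:
  assumes "add_congruence T" "balanced T ract lact f"
  shows "(sweedler (tensor ract lact `` {x}) f, \<Sum>(m, n)\<in>#x. f m n) \<in> T"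
proof -
  have "(x, representative (tensor ract lact `` {x})) \<in> tensor ract lact"
    using representative_in_quotient[OF equiv_tensor, of "tensor ract lact `` {x}" ract lact]
    by (simp add: quotientI flip: eq_equiv_class_iff[OF equiv_tensor UNIV_I UNIV_I])
  then show ?thesis unfolding sweedler_def
    by (rule balanced_sum[OF assms add_congruence_sym[OF add_congruence_tensor]])
qed

lemma sum_mset_sum_mset:
  "(\<Sum>x\<in>#(\<Sum>y\<in>#M. g y). f x) = (\<Sum>y\<in>#M. \<Sum>x\<in>#g y. f x)"
  by (induction M) auto

lemma sum_mset_sweedler:
  "(\<Sum>x\<in>#sweedler X g. f x) = sweedler X (\<lambda>m n. \<Sum>x\<in>#g m n. f x)"
  by (simp add: sweedler_def sum_mset_sum_mset case_prod_unfold)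

lemma sweedler_additive:
  assumes "\<And>x y. g (x + y) = g x + g y" "g 0 = 0"
  shows "g (sweedler X f) = sweedler X (\<lambda>m n. g (f m n))"
proof -
  have "g (\<Sum>x\<in>#M. k x) = (\<Sum>x\<in>#M. g (k x))" for M and k :: "_ \<Rightarrow> _"
    by (induction M) (auto simp: assms)
  then show ?thesis by (simp add: sweedler_def case_prod_unfold)
qed

lemma sweedler_additive_group:
  fixes g :: "'a::ab_group_add \<Rightarrow> 'b::ab_group_add"
  assumes "\<And>x y. g (x + y) = g x + g y"
  shows "g (sweedler X f) = sweedler X (\<lambda>m n. g (f m n))"
  using assms(1)[of 0 0] by (intro sweedler_additive assms) simp

lemma sweedler_mult_left: "(a :: 'a::ring) * sweedler X f = sweedler X (\<lambda>m n. a * f m n)"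
  by (rule sweedler_additive_group) (simp add: distrib_left)

lemma sweedler_mult_right: "sweedler X f * (a :: 'a::ring) = sweedler X (\<lambda>m n. f m n * a)"
  by (rule sweedler_additive_group[of "\<lambda>x. x * a"]) (simp add: distrib_right)

lemma sweedler_plus: "sweedler X (\<lambda>m n. f m n + g m n) = sweedler X f + sweedler X g"
  by (simp add: sweedler_def case_prod_unfold sum_mset.distrib)

lemma sweedler_swap:
  "sweedler X (\<lambda>a b. sweedler Y (f a b)) = sweedler Y (\<lambda>c d. sweedler X (\<lambda>a b. f a b c d))"
  unfolding sweedler_def case_prod_unfold by (rule sum_mset.swap)

lemma sweedler_congruence:
  assumes "add_congruence T" "\<And>m n. (f m n, g m n) \<in> T"
  shows "(sweedler X f, sweedler X g) \<in> T"
  unfolding sweedler_def using assms by (auto intro!: sum_mset_cong_congruence)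

lemma sweedler_zero: "sweedler X (\<lambda>_ _. 0) = 0"
  by (simp add: sweedler_def case_prod_unfold)

lemma sweedler_congruence_zero:
  assumes "add_congruence T" "\<And>m n. (f m n, 0) \<in> T"
  shows "(sweedler X f, 0) \<in> T"
  using sweedler_congruence[OF assms(1), where f = f and g = "\<lambda>_ _. 0" and X = X] assms(2)
  by (simp add: sweedler_zero)

lemma biadditive_sweedler:
  assumes T: "add_congruence T" and "\<And>a b. biadditive T (f a b)"
  shows "biadditive T (\<lambda>x y. sweedler X (\<lambda>a b. f a b x y))"
  using assms(2) unfolding biadditive_def
  by (auto simp flip: sweedler_plus intro!: sweedler_congruence[OF T]
      sweedler_congruence_zero[OF T])

lemma tensor_sweedler_left:
  "({#(sweedler X f, n)#}, sweedler X (\<lambda>x y. {#(f x y, n)#})) \<in> tensor ract lact"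
  unfolding sweedler_def using tensor_sum_left[where f = "case_prod f"] by (simp add: case_prod_unfold)

lemma tensor_sweedler_right:
  "({#(m, sweedler X f)#}, sweedler X (\<lambda>x y. {#(m, f x y)#})) \<in> tensor ract lact"
  unfolding sweedler_def using tensor_sum_right[where f = "case_prod f"] by (simp add: case_prod_unfold)

text \<open>The axioms give the coproduct of a product and the coaction on a product as the class of
  a Sweedler sum; a balanced map is evaluated there termwise.\<close>

lemma sweedler_tensor_image:
  assumes "add_congruence T" "balanced T ract lact f"
  shows "(sweedler (tensor ract lact `` {sweedler X g}) f,
    sweedler X (\<lambda>m n. \<Sum>(x, y)\<in>#g m n. f x y)) \<in> T"
  using sweedler_tensor_congruence[OF assms, of "sweedler X g"]
  by (simp add: sum_mset_sweedler)

lemma sweedler_tensor_add: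
  assumes "add_congruence T" "balanced T ract lact f"
  shows "(sweedler (tensor_add (tensor ract lact) X Y) f, sweedler X f + sweedler Y f) \<in> T"
  using sweedler_tensor_congruence[OF assms, of "representative X + representative Y"]
  by (simp add: tensor_add_def sweedler_def)

text \<open>Turns axioms stated as equalities of classes, such as the Takeuchi conditions, into
  substitution rules under a balanced map; the next lemma does so for the mixed coassociativity
  conditions.\<close>

lemma sweedler_tensor_eq:
  assumes "add_congruence T" "balanced T ract lact f"
    and "tensor ract lact `` {x} = tensor ract lact `` {y}"
  shows "(\<Sum>(m, n)\<in>#x. f m n, \<Sum>(m, n)\<in>#y. f m n) \<in> T"
  using assms(3) by (intro balanced_sum[OF assms(1,2)])
    (simp add: eq_equiv_class_iff[OF equiv_tensor UNIV_I UNIV_I])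

lemma sweedler_tensor3_eq:
  assumes "add_congruence T" "balanced3 T ract1 lact1 ract2 lact2 f"
    and "tensor3 ract1 lact1 ract2 lact2 `` {x} = tensor3 ract1 lact1 ract2 lact2 `` {y}"
  shows "(\<Sum>(m, n, p)\<in>#x. f m n p, \<Sum>(m, n, p)\<in>#y. f m n p) \<in> T"
  using assms(3) by (intro balanced3_sum[OF assms(1,2)])
    (simp add: eq_equiv_class_iff[OF equiv_tensor3 UNIV_I UNIV_I])

section \<open>Maps of tensor products induced by balanced maps\<close>

text \<open>Both \<open>psi\<close> and the actions on a tensor product are of this form.\<close>

definition tensor_lift ::
    "('x multiset \<times> 'x multiset) set \<Rightarrow> ('m \<Rightarrow> 'n \<Rightarrow> 'x multiset) \<Rightarrow>
      ('m \<times> 'n) multiset set \<Rightarrow> 'x multiset set"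
  where "tensor_lift T f X = T `` {sweedler X f}"

lemma congruence_class_eq:
  assumes "add_congruence T" "(x, y) \<in> T"
  shows "T `` {x} = T `` {y}"
  using assms unfolding add_congruence_def by (metis equiv_class_eq)

lemma tensor_lift_in: "tensor_lift T f X \<in> UNIV // T"
  by (simp add: tensor_lift_def quotientI)

lemma tensor_lift_comp:
  assumes "add_congruence T" "balanced T ract lact g"
  shows "tensor_lift T g (tensor_lift (tensor ract lact) f X) =
    tensor_lift T (\<lambda>m n. \<Sum>(x, y)\<in>#f m n. g x y) X"
  unfolding tensor_lift_def
  by (intro congruence_class_eq assms sweedler_tensor_image)

lemma tensor_lift_cong:
  assumes "add_congruence T" "\<And>m n. (f m n, g m n) \<in> T"
  shows "tensor_lift T f X = tensor_lift T g X"
  unfolding tensor_lift_def by (intro congruence_class_eq sweedler_congruence assms)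

lemma tensor_lift_single:
  fixes X :: "('m \<times> 'n) multiset set"
  assumes "equiv UNIV T" "X \<in> UNIV // T"
  shows "tensor_lift T (\<lambda>m n. {#(m, n)#}) X = X"
proof -
  have "(\<Sum>(m, n)\<in>#M. {#(m, n)#}) = M" for M :: "('m \<times> 'n) multiset"
    by (induction M) auto
  then show ?thesis
    using representative_in_quotient[OF assms] by (simp add: tensor_lift_def sweedler_def)
qed

lemma tensor_lift_add:
  assumes "balanced (tensor ract' lact') ract lact f"
  shows "tensor_lift (tensor ract' lact') f (tensor_add (tensor ract lact) X Y) =
    tensor_add (tensor ract' lact') (tensor_lift (tensor ract' lact') f X) (tensor_lift (tensor ract' lact') f Y)"
proof -
  let ?T = "tensor ract' lact'"
  \<comment> \<open>\<open>tensor_add\<close> adds chosen representatives of the two image classes,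
    which agree with the sums themselves only modulo \<open>?T\<close>.\<close>
  have rep: "(x, representative (?T `` {x})) \<in> ?T" for x
    by (simp add: representative_in_quotient[OF equiv_tensor] quotientI
        flip: eq_equiv_class_iff[OF equiv_tensor UNIV_I UNIV_I])
  show ?thesis
    unfolding tensor_lift_def tensor_add_def[of ?T]
    by (intro congruence_class_eq add_congruence_tensor
        add_congruence_trans[OF add_congruence_tensor sweedler_tensor_add[OF add_congruence_tensor assms]]
        add_congruence_add[OF add_congruence_tensor] rep)
qed

text \<open>Composites of lifts are lifts of the termwise composites, so being mutually inverse only
  has to be checked on single tensors.\<close>

lemma tensor_lift_bij:
  assumes "balanced (tensor ract' lact') ract lact f" "balanced (tensor ract lact) ract' lact' g"
    and "\<And>m n. (\<Sum>(x, y)\<in>#f m n. g x y, {#(m, n)#}) \<in> tensor ract lact"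
    and "\<And>m n. (\<Sum>(x, y)\<in>#g m n. f x y, {#(m, n)#}) \<in> tensor ract' lact'"
  shows "bij_betw (tensor_lift (tensor ract' lact') f)
    (UNIV // tensor ract lact) (UNIV // tensor ract' lact')"
proof (rule bij_betw_byWitness[where f' = "tensor_lift (tensor ract lact) g"])
  show "\<forall>X\<in>UNIV // tensor ract lact.
      tensor_lift (tensor ract lact) g (tensor_lift (tensor ract' lact') f X) = X"
    by (simp add: tensor_lift_comp[OF add_congruence_tensor assms(2)]
        tensor_lift_cong[OF add_congruence_tensor assms(3)] tensor_lift_single[OF equiv_tensor])
  show "\<forall>X\<in>UNIV // tensor ract' lact'.
      tensor_lift (tensor ract' lact') f (tensor_lift (tensor ract lact) g X) = X"
    by (simp add: tensor_lift_comp[OF add_congruence_tensor assms(1)]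
        tensor_lift_cong[OF add_congruence_tensor assms(4)] tensor_lift_single[OF equiv_tensor])
qed (auto simp: tensor_lift_in)

section \<open>The antipode is an anti-homomorphism\<close>

context hopf_algebroid
begin

lemma base_maps:
  shows sL_one: "sL 1 = 1" and tL_one: "tL 1 = 1" and sR_one: "sR 1 = 1" and tR_one: "tR 1 = 1"
    and sL_mult: "sL (l * l') = sL l * sL l'" and tL_mult: "tL (l * l') = tL l' * tL l"
    and sR_mult: "sR (r * r') = sR r * sR r'" and tR_mult: "tR (r * r') = tR r' * tR r"
    and sL_add: "sL (l + l') = sL l + sL l'" and tL_add: "tL (l + l') = tL l + tL l'"
    and sR_add: "sR (r + r') = sR r + sR r'" and tR_add: "tR (r + r') = tR r + tR r'"
  using L.source L.target R.source R.target
  by (simp_all add: algebra_map_def algebra_op_map_def k_linear_def)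

lemma S_add: "S (x + y) = S x + S y"
  using S_linear by (simp add: k_linear_def)

lemma S_target:
  shows S_tL_left: "S (tL l * h) = S h * sL l" and S_tL_right: "S (h * tL l) = sL l * S h"
    and S_tR_left: "S (tR r * h) = S h * sR r" and S_tR_right: "S (h * tR r) = sR r * S h"
  using S_tL[of l h 1] S_tL[of 1 h l] S_tR[of r h 1] S_tR[of 1 h r] by (simp_all add: base_maps)

text \<open>\<open>sR r\<close> equals \<open>tL (\<pi>L (sR r))\<close>, and the images of
  \<open>sL\<close> and \<open>tL\<close> commute.\<close>

lemma sL_sR_commute: "sL l * sR r = sR r * sL l"
  using L.source_target_commute[of l "\<pi>L (sR r)"] by (simp add: tL_piL_sR)

lemma S_one: "S 1 = 1"
proof -
  have "sweedler (\<gamma>L 1) (\<lambda>x y. S x * y) = (\<Sum>(x, y)\<in>#{#(1, 1)#}. S x * y)"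
    unfolding L.comult_one
    by (rule sweedler_tensor) (auto simp: S_add S_target algebra_simps)
  then show ?thesis using antipode_left[of 1] by (simp add: R.counit_one base_maps)
qed

text \<open>With \<open>r = \<pi>R h\<close>, the element \<open>tR r\<close> equals
  \<open>sL (\<pi>L (tR r))\<close>, so the coproduct \<open>\<gamma>L\<close> of
  \<open>tR r * h'\<close> arises by multiplying the first leg by \<open>tR r\<close>, which
  \<open>S\<close> turns into a right factor \<open>sR r\<close>. The antipode axiom at
  \<open>tR r * h'\<close> and \<open>R.counit_target\<close> finish.\<close>

lemma antipode_left_mult:
  "sweedler (\<gamma>L h') (\<lambda>x y. S x * sR (\<pi>R h) * y) = sR (\<pi>R (h * h'))"
proof -
  let ?r = "\<pi>R h"
  have "balanced Id (\<lambda>h l. tL l * h) (\<lambda>l h. sL l * h) (\<lambda>x y. S x * y)"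
    by (rule balanced_Id) (auto simp: S_add S_target algebra_simps)
  from sweedler_tensor_image[OF add_congruence_Id this,
      of "\<gamma>L h'" "\<lambda>x y. {#(sL (\<pi>L (tR ?r)) * x, y)#}"]
  have "sweedler (\<gamma>L (sL (\<pi>L (tR ?r)) * h')) (\<lambda>x y. S x * y) =
      sweedler (\<gamma>L h') (\<lambda>x y. S (sL (\<pi>L (tR ?r)) * x) * y)"
    by (simp add: L.comult_lact tensor_lact_def)
  then have "sweedler (\<gamma>L h') (\<lambda>x y. S x * sR ?r * y) = sR (\<pi>R (tR ?r * h'))"
    by (simp add: sL_piL_tR S_target antipode_left)
  then show ?thesis by (simp add: R.counit_target)
qed

lemma antipode_right_mult:
  "sweedler (\<gamma>R h) (\<lambda>x y. sweedler (\<gamma>R h') (\<lambda>x' y'. x * x' * S (y * y'))) = sL (\<pi>L (h * h'))"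
proof -
  have "balanced Id (\<lambda>h r. h * sR r) (\<lambda>r h. h * tR r) (\<lambda>x y. x * S y)"
    by (rule balanced_Id) (auto simp: S_add S_target algebra_simps)
  from sweedler_tensor_image[OF add_congruence_Id this,
      of "\<gamma>R h" "\<lambda>x y. sweedler (\<gamma>R h') (\<lambda>x' y'. {#(x * x', y * y')#})"]
  show ?thesis by (simp add: R.comult_mult[symmetric] antipode_right sum_mset_sweedler)
qed

text \<open>Apply \<open>S\<close> to the counit axiom of \<open>\<gamma>R\<close>; it turns the
  target factor into a source factor on the other side. The next lemma does the same for
  \<open>\<gamma>L\<close>.\<close>

lemma S_expand_right: "S h = sweedler (\<gamma>R h) (\<lambda>x y. sR (\<pi>R x) * S y)"
  using R.counit_left[of h] sweedler_additive_group[of S "\<gamma>R h" "\<lambda>x y. y * tR (\<pi>R x)", OF S_add]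
  by (simp add: S_target)

lemma S_expand_left: "S h = sweedler (\<gamma>L h) (\<lambda>x y. S x * sL (\<pi>L y))"
  using L.counit_right[of h] sweedler_additive_group[of S "\<gamma>L h" "\<lambda>x y. tL (\<pi>L y) * x", OF S_add]
  by (simp add: S_target)

lemma S_expand_mult:
  "S (h * h') = sweedler (\<gamma>R h) (\<lambda>u v. sweedler (\<gamma>R h') (\<lambda>u' v'. sR (\<pi>R (u * u')) * S (v * v')))"
proof -
  have "balanced Id (\<lambda>h r. h * sR r) (\<lambda>r h. h * tR r) (\<lambda>x y. sR (\<pi>R x) * S y)"
    by (rule balanced_Id) (auto simp: S_add S_target base_maps R.counit_add R.counit_ract algebra_simps)
  from sweedler_tensor_image[OF add_congruence_Id this,
      of "\<gamma>R h" "\<lambda>x y. sweedler (\<gamma>R h') (\<lambda>x' y'. {#(x * x', y * y')#})"]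
  show ?thesis by (simp add: R.comult_mult[symmetric] S_expand_right[symmetric] sum_mset_sweedler)
qed

text \<open>\<open>\<pi>L (q * w)\<close> equals \<open>\<pi>L (q * sL l)\<close> for
  \<open>l = \<pi>L w\<close>. The Takeuchi condition trades \<open>q * sL l\<close> for
  \<open>p * tL l\<close>, \<open>S\<close> makes this a factor \<open>sL l\<close> in front, and
  the remaining sum is \<open>S h\<close>.\<close>

lemma S_expand_left_mult:
  "sweedler (\<gamma>L h) (\<lambda>p q. S p * sL (\<pi>L (q * w))) = sL (\<pi>L w) * S h"
proof -
  let ?l = "\<pi>L w"
  have "balanced Id (\<lambda>h l. tL l * h) (\<lambda>l h. sL l * h) (\<lambda>p q. S p * sL (\<pi>L q))"
    by (rule balanced_Id) (auto simp: S_add S_target base_maps L.counit_add L.counit_lact algebra_simps)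
  from sweedler_tensor_eq[OF add_congruence_Id this L.takeuchi[of h ?l]]
  have "sweedler (\<gamma>L h) (\<lambda>p q. S (p * tL ?l) * sL (\<pi>L q)) =
      sweedler (\<gamma>L h) (\<lambda>p q. S p * sL (\<pi>L (q * sL ?l)))"
    by (simp add: sum_mset_sweedler)
  then show ?thesis
    by (simp add: L.counit_source S_target S_expand_left[of h] sweedler_mult_left mult.assoc)
qed

text \<open>Only the Takeuchi property of \<open>\<gamma>\<^sub>R w\<close> makes the summand balanced, which is why the coproduct of \<open>w\<close> has to stay inside when the coproducts of \<open>h\<close> are exchanged.\<close>

lemma antipode_exchange:
  "sweedler (\<gamma>R h) (\<lambda>u v. sweedler (\<gamma>R w) (\<lambda>y z. sR (\<pi>R u) * y * S (v * z))) = sL (\<pi>L w) * S h"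
proof -
  let ?F = "\<lambda>p q v. sweedler (\<gamma>R w) (\<lambda>y z. S p * q * y * S (v * z))"
  have tak: "sweedler (\<gamma>R w) (\<lambda>y z. S p * q * (sR r * y) * S (v * z)) =
      sweedler (\<gamma>R w) (\<lambda>y z. S p * q * y * S (v * (tR r * z)))" for p q v r
  proof -
    have "balanced Id (\<lambda>h r. h * sR r) (\<lambda>r h. h * tR r) (\<lambda>y z. S p * q * y * S (v * z))"
    proof (rule balanced_Id)
      show "S p * q * (m * sR b) * S (v * n) = S p * q * m * S (v * (n * tR b))" for m n b
        using S_tR_right[of "v * n" b] by (simp add: mult.assoc)
    qed (auto simp: S_add algebra_simps)
    from sweedler_tensor_eq[OF add_congruence_Id this R.takeuchi[of w r]]
    show ?thesis by (simp add: sum_mset_sweedler)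
  qed
  have F: "balanced3 Id (\<lambda>h l. tL l * h) (\<lambda>l h. sL l * h) (\<lambda>h r. h * sR r) (\<lambda>r h. h * tR r) ?F"
    unfolding balanced3_def
  proof (intro conjI allI balanced_Id)
    show "?F m (n * sR b) v = ?F m n (v * tR b)" for m n b v
      using tak[of m n b v] by (simp add: mult.assoc)
  qed (auto simp: S_add S_target distrib_left distrib_right sweedler_plus mult.assoc)
  \<comment> \<open>The scalar \<open>sR (\<pi>R u)\<close> is opened up as S(u_(1)) u_(2), so that
    mixed coassociativity can exchange the two coproducts of \<open>h\<close>; then
    \<open>antipode_right_mult\<close> contracts the right-hand factors.\<close>
  have "sweedler (\<gamma>R h) (\<lambda>u v. sweedler (\<gamma>R w) (\<lambda>y z. sR (\<pi>R u) * y * S (v * z))) =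
      sweedler (\<gamma>R h) (\<lambda>u v. sweedler (\<gamma>L u) (\<lambda>p q. ?F p q v))"
    unfolding antipode_left[symmetric] sweedler_mult_right
    by (simp only: sweedler_swap[of "\<gamma>R w"])
  also have "\<dots> = sweedler (\<gamma>L h) (\<lambda>p q. sweedler (\<gamma>R q) (\<lambda>q1 q2. ?F p q1 q2))"
    using sweedler_tensor3_eq[OF add_congruence_Id F mixed_coassoc_LR[of h]]
    by (simp add: sum_mset_sweedler)
  also have "\<dots> = sweedler (\<gamma>L h) (\<lambda>p q. S p * sL (\<pi>L (q * w)))"
    by (simp add: antipode_right_mult[symmetric] sweedler_mult_left mult.assoc)
  also have "\<dots> = sL (\<pi>L w) * S h"
    by (rule S_expand_left_mult)
  finally show ?thesis .
qed

text \<open>The coproducts of \<open>h'\<close> are exchanged here, with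
  \<open>sR (\<pi>R u)\<close> carried along as the contracted part of \<open>h\<close>; those of
  \<open>h\<close> are exchanged in \<open>antipode_exchange\<close>.\<close>

lemma S_mult: "S (h * h') = S h' * S h"
proof -
  have F: "balanced3 Id (\<lambda>h l. tL l * h) (\<lambda>l h. sL l * h) (\<lambda>h r. h * sR r) (\<lambda>r h. h * tR r)
      (\<lambda>x y z. S x * sR (\<pi>R u) * y * S (v * z))" for u v
    unfolding balanced3_def
  proof (intro conjI allI balanced_Id)
    \<comment> \<open>\<open>S\<close> sends \<open>tL b * m\<close> to \<open>S m * sL b\<close>,
      and \<open>sL b\<close> has to pass \<open>sR (\<pi>R u)\<close> to reach
      \<open>n\<close>.\<close>
    show "S (tL b * m) * sR (\<pi>R u) * n * S (v * p) = S m * sR (\<pi>R u) * (sL b * n) * S (v * p)" for b m n p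
      using sL_sR_commute[of b "\<pi>R u"] by (simp add: S_target flip: mult.assoc) (simp add: mult.assoc)
    show "S m * sR (\<pi>R u) * (n * sR b) * S (v * p) = S m * sR (\<pi>R u) * n * S (v * (p * tR b))" for b m n p
      using S_tR_right[of "v * p" b] by (simp add: mult.assoc)
  qed (auto simp: S_add distrib_left distrib_right)
  have "S (h * h') = sweedler (\<gamma>R h) (\<lambda>u v. sweedler (\<gamma>R h') (\<lambda>u' v'.
      sweedler (\<gamma>L u') (\<lambda>x y. S x * sR (\<pi>R u) * y * S (v * v'))))"
    by (subst S_expand_mult) (simp add: antipode_left_mult[symmetric] sweedler_mult_right)
  also have "\<dots> = sweedler (\<gamma>R h) (\<lambda>u v. sweedler (\<gamma>L h') (\<lambda>x w.
      sweedler (\<gamma>R w) (\<lambda>y z. S x * sR (\<pi>R u) * y * S (v * z))))"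
    using sweedler_tensor3_eq[OF add_congruence_Id F mixed_coassoc_LR[of h']]
    by (simp add: sum_mset_sweedler)
  also have "\<dots> = sweedler (\<gamma>L h') (\<lambda>x w. S x * sweedler (\<gamma>R h) (\<lambda>u v.
      sweedler (\<gamma>R w) (\<lambda>y z. sR (\<pi>R u) * y * S (v * z))))"
    by (subst sweedler_swap) (simp add: sweedler_mult_left mult.assoc)
  also have "\<dots> = S h' * S h"
    unfolding antipode_exchange
    by (subst S_expand_left[of h']) (simp add: sweedler_mult_right mult.assoc)
  finally show ?thesis .
qed

section \<open>The inverse of the antipode\<close>

context
  assumes bij_S: "bij S"
begin

lemma inv_S_S: "inv S (S h) = h" and S_inv_S: "S (inv S h) = h"
  using bij_S by (simp_all add: bij_is_inj bij_is_surj surj_f_inv_f)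

lemma inv_S_add: "inv S (x + y) = inv S x + inv S y"
  by (metis S_add inv_S_S S_inv_S)

lemma inv_S_mult: "inv S (x * y) = inv S y * inv S x"
  by (metis S_mult inv_S_S S_inv_S)

lemma inv_S_source:
  shows inv_S_sL: "inv S (sL l) = tL l" and inv_S_sR: "inv S (sR r) = tR r"
proof -
  have "S (tL l) = sL l" "S (tR r) = sR r"
    using S_tL_left[of l 1] S_tR_left[of r 1] by (simp_all add: S_one)
  then show "inv S (sL l) = tL l" "inv S (sR r) = tR r"
    using inv_S_S[of "tL l"] inv_S_S[of "tR r"] by simp_all
qed

lemma inv_antipode_left: "sweedler (\<gamma>L h) (\<lambda>x y. inv S y * x) = tR (\<pi>R h)"
  using sweedler_additive_group[where g = "inv S", OF inv_S_add, of "\<gamma>L h" "\<lambda>x y. S x * y"]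
  by (simp add: antipode_left inv_S_mult inv_S_S inv_S_sR)

lemma inv_antipode_right: "sweedler (\<gamma>R h) (\<lambda>x y. y * inv S x) = tL (\<pi>L h)"
  using sweedler_additive_group[where g = "inv S", OF inv_S_add, of "\<gamma>R h" "\<lambda>x y. x * S y"]
  by (simp add: antipode_right inv_S_mult inv_S_S inv_S_sL)

end

end

section \<open>Coactions on a comodule algebra\<close>

context hopf_comodule_algebra
begin

abbreviation lact_L where "lact_L \<equiv> comodule_lact_L sL \<pi>L ractL \<tau>L"
abbreviation lact_R where "lact_R \<equiv> comodule_lact_R sR \<pi>R ractR \<tau>R"

text \<open>The compatibility of the actions at 1. It presents the right L-action as a left
  R-action, which can be moved across a tensor product over R.\<close>

lemma ractL_eq: "ractL m l = lact_R (\<pi>R (tL l)) m"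
  using actions_agree[of 1 m l]
  by (simp add: L.lact_one R.M.ract_one H.base_maps H.R.counit_one)

text \<open>The element \<open>\<pi>L (sR r)\<close> is chosen because \<open>tL\<close> sends it to
  \<open>sR r\<close>, which \<open>\<pi>R\<close> sends back to \<open>r\<close>.\<close>

lemma ractR_eq: "ractR m r = lact_L (\<pi>L (sR r)) m"
proof -
  have "\<pi>R (sR r) = r" using H.R.counit_ract[of 1 r] by (simp add: H.R.counit_one)
  then show ?thesis
    using actions_agree[of "\<pi>L (sR r)" m 1]
    by (simp add: L.M.ract_one R.lact_one H.base_maps H.R.counit_one H.tL_piL_sR)
qed

text \<open>The left action of \<open>l\<close> is right multiplication by \<open>ractL 1 l\<close>,
  so its effect on the coaction is determined by the coaction on this one element.\<close>

lemma coactL_unit: "\<tau>L (ractL 1 l) = tensor ractL (\<lambda>l h. sL l * h) `` {{#(1, tL l)#}}"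
proof -
  have "balanced (tensor ractL (\<lambda>l h. sL l * h)) ractL (\<lambda>l h. sL l * h) (\<lambda>x y. {#(x, tL l * y)#})"
    unfolding balanced_def
  proof (intro conjI allI)
    show "({#(ractL m b, tL l * n)#}, {#(m, tL l * (sL b * n))#}) \<in> tensor ractL (\<lambda>l h. sL l * h)" for m b n
      using tensor_balanced[of ractL m b "tL l * n" "\<lambda>l h. sL l * h"]
      by (simp add: H.L.source_target_commute flip: mult.assoc)
  qed (auto intro: biadditive_comp[OF biadditive_single] simp: distrib_left)
  from sweedler_tensor_congruence[OF add_congruence_tensor this, of "{#(1, 1)#}"]
  show ?thesis
    unfolding L.coact_ract tensor_ract_def LA.coact_one
    by (intro congruence_class_eq add_congruence_tensor) simp
qed

lemma coactR_unit: "\<tau>R (ractR 1 r) = tensor ractR (\<lambda>r h. h * tR r) `` {{#(1, sR r)#}}"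
proof -
  have "balanced (tensor ractR (\<lambda>r h. h * tR r)) ractR (\<lambda>r h. h * tR r) (\<lambda>x y. {#(x, y * sR r)#})"
    unfolding balanced_def
  proof (intro conjI allI)
    show "({#(ractR m b, n * sR r)#}, {#(m, n * tR b * sR r)#}) \<in> tensor ractR (\<lambda>r h. h * tR r)" for m b n
      using tensor_balanced[of ractR m b "n * sR r" "\<lambda>r h. h * tR r"]
      by (simp add: H.R.source_target_commute mult.assoc)
  qed (auto intro: biadditive_comp[OF biadditive_single] simp: distrib_right)
  from sweedler_tensor_congruence[OF add_congruence_tensor this, of "{#(1, 1)#}"]
  show ?thesis
    unfolding R.coact_ract tensor_ract_def RA.coact_one
    by (intro congruence_class_eq add_congruence_tensor) simp
qed

text \<open>The left action is defined through the coaction, which is 1 \<otimes> 1 at 1. By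
  \<open>ring_lact\<close>, acting with \<open>r\<close> from the left is thus left multiplication
  by \<open>ractR 1 r\<close>.\<close>

lemma lactR_one: "lact_R r 1 = ractR 1 r"
proof -
  have "\<pi>R (sR r) = r" using H.R.counit_ract[of 1 r] by (simp add: H.R.counit_one)
  moreover have "lact_R r 1 = (\<Sum>(x, y)\<in>#{#(1, 1)#}. ractR x (\<pi>R (sR r * y)))"
    unfolding comodule_lact_R_def RA.coact_one
    using H.R.counit_lact
    by (intro sweedler_tensor)
      (auto simp: R.M.ract_add_left R.M.ract_add_right H.R.counit_add distrib_left R.M.ract_mult[symmetric]
        mult.assoc[symmetric])
  ultimately show ?thesis by simp
qed

text \<open>The summand is balanced in the coaction of the second factor only after summing over the first
  one, by the Takeuchi property.\<close>

lemma coactL_lact: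
  assumes T: "add_congruence T" and f: "balanced T ractL (\<lambda>l h. sL l * h) f"
  shows "(sweedler (\<tau>L (lact_L l a)) f, sweedler (\<tau>L a) (\<lambda>x y. f x (y * tL l))) \<in> T"
proof -
  \<comment> \<open>As \<open>lact_L l a\<close> is \<open>a * ractL 1 l\<close> and the coaction is
    multiplicative, the sum sought is \<open>?G\<close> evaluated at
    \<open>\<tau>L (ractL 1 l)\<close>, the class of 1 \<otimes> \<open>tL l\<close>.\<close>
  let ?G = "\<lambda>x y. sweedler (\<tau>L a) (\<lambda>a0 a1. f (a0 * x) (a1 * y))"
  have bi: "biadditive T f" and mid: "\<And>m b n. (f (ractL m b) n, f m (sL b * n)) \<in> T"
    using f by (auto simp: balanced_def)
  have f': "balanced T ractL (\<lambda>l h. sL l * h) (\<lambda>a0 a1. f (a0 * x) (a1 * y))" for x y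
    unfolding balanced_def
  proof (intro conjI allI)
    show "(f (ractL m b * x) (n * y), f (m * x) (sL b * n * y)) \<in> T" for m b n
      using mid[of "m * x" b "n * y"] LA.op_ring_ract[of m b] LA.op_ring_ract[of "m * x" b]
      by (simp add: mult.assoc)
  qed (auto intro: biadditive_comp[OF bi] simp: distrib_right)
  have "balanced T ractL (\<lambda>l h. sL l * h) ?G"
    unfolding balanced_def
  proof (intro conjI allI)
    fix x b y
    \<comment> \<open>The factor \<open>ractL 1 b\<close> in front of \<open>x\<close>, read as
      standing behind \<open>a0\<close>, is the left action of \<open>b\<close> on
      \<open>a0\<close>, to which the Takeuchi condition applies.\<close>
    have "(sweedler (\<tau>L a) (\<lambda>a0 a1. f (lact_L b a0 * x) (a1 * y)),
        sweedler (\<tau>L a) (\<lambda>a0 a1. f (a0 * x) (a1 * sL b * y))) \<in> T"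
      using sweedler_tensor_eq[OF T f' L.coact_takeuchi[of a b]] by (simp add: sum_mset_sweedler)
    then show "(?G (ractL x b) y, ?G x (sL b * y)) \<in> T"
      by (simp add: LA.op_ring_lact LA.op_ring_ract[of x b] mult.assoc)
  qed (auto intro!: biadditive_sweedler[OF T] biadditive_comp[OF bi] simp: distrib_left)
  from sweedler_tensor_congruence[OF T this, of "{#(1, tL l)#}"]
  have "(sweedler (\<tau>L (ractL 1 l)) ?G, sweedler (\<tau>L a) (\<lambda>x y. f x (y * tL l))) \<in> T"
    by (simp add: coactL_unit)
  moreover have "(sweedler (\<tau>L (lact_L l a)) f, sweedler (\<tau>L (ractL 1 l)) ?G) \<in> T"
    using sweedler_tensor_image[OF T f, of "\<tau>L a"
        "\<lambda>a0 a1. sweedler (\<tau>L (ractL 1 l)) (\<lambda>x y. {#(a0 * x, a1 * y)#})"]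
    by (subst sweedler_swap) (simp add: LA.op_ring_lact LA.coact_mult sum_mset_sweedler)
  ultimately show ?thesis by (rule add_congruence_trans[OF T, rotated])
qed

text \<open>The same argument with the factors exchanged: \<open>lact_R r a\<close> is
  \<open>ractR 1 r * a\<close>, so the inner sum runs over the coaction on the second factor
  \<open>a\<close>.\<close>

lemma coactR_lact:
  assumes T: "add_congruence T" and f: "balanced T ractR (\<lambda>r h. h * tR r) f"
  shows "(sweedler (\<tau>R (lact_R r a)) f, sweedler (\<tau>R a) (\<lambda>x y. f x (sR r * y))) \<in> T"
proof -
  let ?G = "\<lambda>x y. sweedler (\<tau>R a) (\<lambda>a0 a1. f (x * a0) (y * a1))"
  have bi: "biadditive T f" and mid: "\<And>m b n. (f (ractR m b) n, f m (n * tR b)) \<in> T"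
    using f by (auto simp: balanced_def)
  have f': "balanced T ractR (\<lambda>r h. h * tR r) (\<lambda>a0 a1. f (x * a0) (y * a1))" for x y
    unfolding balanced_def
  proof (intro conjI allI)
    show "(f (x * ractR m b) (y * n), f (x * m) (y * (n * tR b))) \<in> T" for m b n
      using mid[of "x * m" b "y * n"] by (simp add: RA.ring_ract mult.assoc)
  qed (auto intro: biadditive_comp[OF bi] simp: distrib_left)
  have "balanced T ractR (\<lambda>r h. h * tR r) ?G"
    unfolding balanced_def
  proof (intro conjI allI)
    fix x b y
    have "(sweedler (\<tau>R a) (\<lambda>a0 a1. f (x * lact_R b a0) (y * a1)),
        sweedler (\<tau>R a) (\<lambda>a0 a1. f (x * a0) (y * (tR b * a1)))) \<in> T"
      using sweedler_tensor_eq[OF T f' R.coact_takeuchi[of a b]] by (simp add: sum_mset_sweedler)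
    then show "(?G (ractR x b) y, ?G x (y * tR b)) \<in> T"
      by (simp add: RA.ring_balanced mult.assoc)
  qed (auto intro!: biadditive_sweedler[OF T] biadditive_comp[OF bi] simp: distrib_right)
  from sweedler_tensor_congruence[OF T this, of "{#(1, sR r)#}"]
  have "(sweedler (\<tau>R (ractR 1 r)) ?G, sweedler (\<tau>R a) (\<lambda>x y. f x (sR r * y))) \<in> T"
    by (simp add: coactR_unit)
  moreover have "(sweedler (\<tau>R (lact_R r a)) f, sweedler (\<tau>R (ractR 1 r)) ?G) \<in> T"
    using sweedler_tensor_image[OF T f, of "\<tau>R (ractR 1 r)"
        "\<lambda>x y. sweedler (\<tau>R a) (\<lambda>a0 a1. {#(x * a0, y * a1)#})"] RA.ring_lact[of r 1 a]
    by (simp add: RA.coact_mult sum_mset_sweedler lactR_one)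
  ultimately show ?thesis by (rule add_congruence_trans[OF T, rotated])
qed

section \<open>The map \<open>\<psi>\<close> and its inverse\<close>

abbreviation HA where "HA \<equiv> tensor (\<lambda>h r. h * sR r) lact_R"
abbreviation AH where "AH \<equiv> tensor ractR (\<lambda>r h. h * tR r)"

definition psi_sum :: "'h \<Rightarrow> 'a \<Rightarrow> ('a \<times> 'h) multiset"
  where "psi_sum h a = sweedler (\<tau>R a) (\<lambda>a0 a1. {#(a0, h * a1)#})"

definition psi_inv_sum :: "'a \<Rightarrow> 'h \<Rightarrow> ('h \<times> 'a) multiset"
  where "psi_inv_sum a h = sweedler (\<tau>L a) (\<lambda>a0 a1. {#(h * inv S a1, a0)#})"

lemma psi_sum_balanced_inner: "balanced AH ractR (\<lambda>r h. h * tR r) (\<lambda>m n. {#(m, h * n)#})"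
  unfolding balanced_def
proof (intro conjI allI)
  show "({#(ractR m b, h * n)#}, {#(m, h * (n * tR b))#}) \<in> AH" for m b n
    using tensor_balanced[of ractR m b "h * n" "\<lambda>r h. h * tR r"] by (simp add: mult.assoc)
qed (auto intro: biadditive_comp[OF biadditive_single] simp: distrib_left)

lemma psi_sum_ract: "(psi_sum h (ractR a r), sweedler (\<tau>R a) (\<lambda>a0 a1. {#(a0, h * a1 * sR r)#})) \<in> AH"
  using sweedler_tensor_image[OF add_congruence_tensor psi_sum_balanced_inner[of h],
      of "\<tau>R a" "\<lambda>m n. {#(m, n * sR r)#}"]
  by (simp add: psi_sum_def R.coact_ract tensor_ract_def mult.assoc)

lemma psi_sum_balanced: "balanced AH (\<lambda>h r. h * sR r) lact_R psi_sum"
  unfolding balanced_def biadditive_def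
proof (intro conjI allI)
  show "(psi_sum (m + m') n, psi_sum m n + psi_sum m' n) \<in> AH" for m m' n
    unfolding psi_sum_def sweedler_plus[symmetric] distrib_right
    by (intro sweedler_congruence add_congruence_tensor tensor_add_right)
  show "(psi_sum m (n + n'), psi_sum m n + psi_sum m n') \<in> AH" for m n n'
    unfolding psi_sum_def R.coact_add
    by (rule sweedler_tensor_add[OF add_congruence_tensor psi_sum_balanced_inner])
  have zero: "(sweedler X (\<lambda>m n. {#(m, 0)#}), 0) \<in> AH" for X :: "('a \<times> 'h) multiset set"
    by (intro sweedler_congruence_zero add_congruence_tensor tensor_zero_right)
  show "(psi_sum 0 n, 0) \<in> AH" for n
    using zero by (simp add: psi_sum_def)
  \<comment> \<open>Zero is written as \<open>ractR 0 0\<close>: right linearity of the coaction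
    then puts a factor \<open>sR 0 = 0\<close> into every \<open>H\<close> component.\<close>
  show "(psi_sum m 0, 0) \<in> AH" for m
  proof -
    have "ractR 0 0 = 0" "sR 0 = 0"
      using R.M.ract_add_left[of 0 0 0] H.sR_add[of 0 0] by simp_all
    then show ?thesis
      using psi_sum_ract[of m 0 0] add_congruence_trans[OF add_congruence_tensor _ zero] by simp
  qed
  show "(psi_sum (m * sR b) n, psi_sum m (lact_R b n)) \<in> AH" for m b n
    using coactR_lact[OF add_congruence_tensor psi_sum_balanced_inner[of m]]
    by - (rule add_congruence_sym[OF add_congruence_tensor], simp add: psi_sum_def mult.assoc)
qed

context
  assumes bij_S: "bij S"
begin

lemmas inv_S = H.inv_S_add[OF bij_S] H.inv_S_mult[OF bij_S] H.inv_S_sL[OF bij_S] H.inv_S_sR[OF bij_S]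

text \<open>\<open>tL l\<close> equals \<open>sR (\<pi>R (tL l))\<close>, so it crosses the tensor
  product over R, and the resulting left R-action is the right action of \<open>l\<close>.\<close>

lemma HA_tL: "({#(h * tL l, a)#}, {#(h, ractL a l)#}) \<in> HA"
  using tensor_balanced[of "\<lambda>h r. h * sR r" h "\<pi>R (tL l)" a lact_R]
  by (simp add: H.sR_piR_tL ractL_eq)

text \<open>Makes the inverse independent of the representative of the coaction:
  \<open>inv S\<close> turns a left factor \<open>sL b\<close> into a right factor
  \<open>tL b\<close>, which \<open>HA_tL\<close> moves to \<open>A\<close>.\<close>

lemma psi_inv_sum_balanced_inner:
  "balanced HA ractL (\<lambda>l h. sL l * h) (\<lambda>m n. {#(h * inv S n, m)#})"
  unfolding balanced_def
proof (intro conjI allI)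
  show "({#(h * inv S n, ractL m b)#}, {#(h * inv S (sL b * n), m)#}) \<in> HA" for m b n
    using add_congruence_sym[OF add_congruence_tensor HA_tL[of "h * inv S n" b m]]
    by (simp add: inv_S mult.assoc)
  show "biadditive HA (\<lambda>m n. {#(h * inv S n, m)#})"
    by (rule biadditive_swap, rule biadditive_comp[OF biadditive_single])
      (auto simp: inv_S distrib_left)
qed

lemma psi_inv_sum_balanced: "balanced HA ractR (\<lambda>r h. h * tR r) psi_inv_sum"
  unfolding balanced_def biadditive_def
proof (intro conjI allI)
  show "(psi_inv_sum m (n + n'), psi_inv_sum m n + psi_inv_sum m n') \<in> HA" for m n n'
    unfolding psi_inv_sum_def sweedler_plus[symmetric] distrib_right
    by (intro sweedler_congruence add_congruence_tensor tensor_add_left)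
  show "(psi_inv_sum (m + m') n, psi_inv_sum m n + psi_inv_sum m' n) \<in> HA" for m m' n
    unfolding psi_inv_sum_def L.coact_add
    by (rule sweedler_tensor_add[OF add_congruence_tensor psi_inv_sum_balanced_inner])
  have zero: "(sweedler X (\<lambda>m n. {#(0, m)#}), 0) \<in> HA" for X :: "('a \<times> 'h) multiset set"
    by (intro sweedler_congruence_zero add_congruence_tensor tensor_zero_left)
  show "(psi_inv_sum m 0, 0) \<in> HA" for m
    using zero by (simp add: psi_inv_sum_def)
  show "(psi_inv_sum 0 n, 0) \<in> HA" for n
  proof -
    have "ractL 0 0 = 0" "tL 0 = 0" "inv S 0 = 0"
      using L.M.ract_add_left[of 0 0 0] H.tL_add[of 0 0] inv_S(1)[of 0 0] by simp_all
    moreover have "(psi_inv_sum (ractL 0 0) n, sweedler (\<tau>L 0) (\<lambda>m k. {#(n * inv S (tL 0 * k), m)#})) \<in> HA"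
      using sweedler_tensor_image[OF add_congruence_tensor psi_inv_sum_balanced_inner[of n],
          of "\<tau>L 0" "\<lambda>m k. {#(m, tL 0 * k)#}"]
      by (simp add: psi_inv_sum_def L.coact_ract tensor_ract_def)
    ultimately show ?thesis
      using add_congruence_trans[OF add_congruence_tensor _ zero] by simp
  qed
  \<comment> \<open>\<open>ractR m b\<close> is the left action of \<open>\<pi>L (sR b)\<close>, so
    \<open>coactL_lact\<close> multiplies the \<open>H\<close> leg on the right by
    \<open>tL (\<pi>L (sR b)) = sR b\<close>, and \<open>inv S\<close> turns this into
    \<open>tR b\<close> on the left.\<close>
  show "(psi_inv_sum (ractR m b) n, psi_inv_sum m (n * tR b)) \<in> HA" for m b n
    using coactL_lact[OF add_congruence_tensor psi_inv_sum_balanced_inner[of n], of "\<pi>L (sR b)" m]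
    by (simp add: psi_inv_sum_def mult.assoc ractR_eq H.tL_piL_sR inv_S)
qed

text \<open>By mixed coassociativity, \<open>inv_antipode_right\<close>, \<open>HA_tL\<close> and
  the counit in turn: h a^<1> S^{-1}(a^<0>_<1>) \<otimes> a^<0>_<0> = h a_<1>^(2) S^{-1}(a_<1>^(1))
  \<otimes> a_<0> = h t_L(\<pi>_L(a_<1>)) \<otimes> a_<0> = h \<otimes> a_<0> \<pi>_L(a_<1>) = h
  \<otimes> a.\<close>

lemma psi_inv_sum_psi_sum: "(\<Sum>(x, y)\<in>#psi_sum h a. psi_inv_sum x y, {#(h, a)#}) \<in> HA"
proof -
  note [trans] = add_congruence_trans[OF add_congruence_tensor]
  let ?F = "\<lambda>m x y. {#(h * y * inv S x, m)#}"
  have F: "balanced3 HA ractL (\<lambda>l h. sL l * h) (\<lambda>h r. h * sR r) (\<lambda>r h. h * tR r) ?F"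
    unfolding balanced3_def
  proof (intro conjI allI psi_inv_sum_balanced_inner)
    show "balanced HA (\<lambda>h r. h * sR r) (\<lambda>r h. h * tR r) (?F m)" for m
      unfolding balanced_def
    proof (intro conjI allI)
      show "biadditive HA (?F m)"
        by (rule biadditive_tensor_left) (simp_all add: inv_S distrib_left distrib_right)
    qed (simp add: inv_S mult.assoc add_congruence_refl[OF add_congruence_tensor])
  qed
  have "(\<Sum>(x, y)\<in>#psi_sum h a. psi_inv_sum x y,
      sweedler (\<tau>L a) (\<lambda>m n. sweedler (\<gamma>R n) (\<lambda>x y. ?F m x y))) \<in> HA"
    using sweedler_tensor3_eq[OF add_congruence_tensor F coact_mixed_LR[of a]]
    by (simp add: sum_mset_sweedler psi_sum_def psi_inv_sum_def)
  also have "(sweedler (\<tau>L a) (\<lambda>m n. sweedler (\<gamma>R n) (\<lambda>x y. ?F m x y)),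
      sweedler (\<tau>L a) (\<lambda>m n. {#(h, ractL m (\<pi>L n))#})) \<in> HA"
  proof (rule sweedler_congruence[OF add_congruence_tensor])
    fix m n
    have "(sweedler (\<gamma>R n) (\<lambda>x y. ?F m x y), {#(sweedler (\<gamma>R n) (\<lambda>x y. h * y * inv S x), m)#}) \<in> HA"
      by (rule add_congruence_sym[OF add_congruence_tensor tensor_sweedler_left])
    also have "sweedler (\<gamma>R n) (\<lambda>x y. h * y * inv S x) = h * tL (\<pi>L n)"
      by (simp add: H.inv_antipode_right[OF bij_S, symmetric] sweedler_mult_left mult.assoc)
    also note HA_tL
    finally show "(sweedler (\<gamma>R n) (\<lambda>x y. ?F m x y), {#(h, ractL m (\<pi>L n))#}) \<in> HA" .
  qed
  also have "(sweedler (\<tau>L a) (\<lambda>m n. {#(h, ractL m (\<pi>L n))#}), {#(h, a)#}) \<in> HA"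
    using add_congruence_sym[OF add_congruence_tensor
        tensor_sweedler_right[where f = "\<lambda>m n. ractL m (\<pi>L n)" and X = "\<tau>L a"]]
    by (simp add: L.coact_counit)
  finally show ?thesis .
qed

text \<open>By mixed coassociativity, \<open>inv_antipode_left\<close>, R-balancedness and the
  counit in turn: a_<0>^<0> \<otimes> h S^{-1}(a_<1>) a_<0>^<1> = a^<0> \<otimes> h
  S^{-1}(a^<1>_(2)) a^<1>_(1) = a^<0> \<otimes> h t_R(\<pi>_R(a^<1>)) = a^<0> \<pi>_R(a^<1>)
  \<otimes> h = a \<otimes> h.\<close>

lemma psi_sum_psi_inv_sum: "(\<Sum>(x, y)\<in>#psi_inv_sum a h. psi_sum x y, {#(a, h)#}) \<in> AH"
proof -
  note [trans] = add_congruence_trans[OF add_congruence_tensor]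
  let ?F = "\<lambda>m x y. {#(m, h * inv S y * x)#}"
  have F: "balanced3 AH ractR (\<lambda>r h. h * tR r) (\<lambda>h l. tL l * h) (\<lambda>l h. sL l * h) ?F"
    unfolding balanced3_def
  proof (intro conjI allI psi_sum_balanced_inner)
    show "balanced AH (\<lambda>h l. tL l * h) (\<lambda>l h. sL l * h) (?F m)" for m
      unfolding balanced_def
    proof (intro conjI allI)
      show "biadditive AH (?F m)"
        by (rule biadditive_tensor_right) (simp_all add: inv_S distrib_left distrib_right)
    qed (simp add: inv_S mult.assoc add_congruence_refl[OF add_congruence_tensor])
  qed
  have "(\<Sum>(x, y)\<in>#psi_inv_sum a h. psi_sum x y,
      sweedler (\<tau>R a) (\<lambda>m n. sweedler (\<gamma>L n) (\<lambda>x y. ?F m x y))) \<in> AH"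
    using sweedler_tensor3_eq[OF add_congruence_tensor F coact_mixed_RL[of a]]
    by (simp add: sum_mset_sweedler psi_sum_def psi_inv_sum_def)
  also have "(sweedler (\<tau>R a) (\<lambda>m n. sweedler (\<gamma>L n) (\<lambda>x y. ?F m x y)),
      sweedler (\<tau>R a) (\<lambda>m n. {#(ractR m (\<pi>R n), h)#})) \<in> AH"
  proof (rule sweedler_congruence[OF add_congruence_tensor])
    fix m n
    have "(sweedler (\<gamma>L n) (\<lambda>x y. ?F m x y), {#(m, sweedler (\<gamma>L n) (\<lambda>x y. h * inv S y * x))#}) \<in> AH"
      by (rule add_congruence_sym[OF add_congruence_tensor tensor_sweedler_right])
    also have "sweedler (\<gamma>L n) (\<lambda>x y. h * inv S y * x) = h * tR (\<pi>R n)"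
      by (simp add: H.inv_antipode_left[OF bij_S, symmetric] sweedler_mult_left mult.assoc)
    also have "({#(m, h * tR (\<pi>R n))#}, {#(ractR m (\<pi>R n), h)#}) \<in> AH"
      by (rule add_congruence_sym[OF add_congruence_tensor tensor_balanced])
    finally show "(sweedler (\<gamma>L n) (\<lambda>x y. ?F m x y), {#(ractR m (\<pi>R n), h)#}) \<in> AH" .
  qed
  also have "(sweedler (\<tau>R a) (\<lambda>m n. {#(ractR m (\<pi>R n), h)#}), {#(a, h)#}) \<in> AH"
    using add_congruence_sym[OF add_congruence_tensor
        tensor_sweedler_left[where f = "\<lambda>m n. ractR m (\<pi>R n)" and X = "\<tau>R a"]]
    by (simp add: R.coact_counit)
  finally show ?thesis .
qed

end

section \<open>The map \<open>psi\<close> on single tensors and its R-linearity on both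
  sides\<close>

lemma psi_eq: "psi AH \<tau>R = tensor_lift AH psi_sum"
  by (simp add: psi_def tensor_lift_def psi_sum_def[abs_def] fun_eq_iff)

lemma psi_single: "psi AH \<tau>R (HA `` {{#(h, a)#}}) = AH `` {psi_sum h a}"
  using sweedler_tensor_congruence[OF add_congruence_tensor psi_sum_balanced, of "{#(h, a)#}"]
  unfolding psi_eq tensor_lift_def by (intro congruence_class_eq add_congruence_tensor) simp

text \<open>This is the Takeuchi condition of the coaction: the factor \<open>tR r\<close> in front
  of a^<1> is traded for the left action of \<open>r\<close> on a^<0>.\<close>

lemma psi_lact:
  "psi AH \<tau>R (tensor_lact HA (\<lambda>r h. h * tR r) r X) = tensor_lact AH lact_R r (psi AH \<tau>R X)"
proof -
  have "balanced AH ractR (\<lambda>r h. h * tR r) (\<lambda>m n. {#(lact_R r m, n)#})"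
    unfolding balanced_def
  proof (intro conjI allI)
    show "({#(lact_R r (ractR m b), n)#}, {#(lact_R r m, n * tR b)#}) \<in> AH" for m b n
      using tensor_balanced[of ractR "lact_R r m" b n "\<lambda>r h. h * tR r"] by (simp add: R.lact_ract)
  qed (auto intro: biadditive_comp[OF biadditive_single] simp: R.lact_add_right)
  note comp = tensor_lift_comp[OF add_congruence_tensor this]
  have "(psi_sum (h * tR r) a, \<Sum>(m, n)\<in>#psi_sum h a. {#(lact_R r m, n)#}) \<in> AH" for h a
    using sweedler_tensor_eq[OF add_congruence_tensor psi_sum_balanced_inner[of h] R.coact_takeuchi[of a r]]
    by - (rule add_congruence_sym[OF add_congruence_tensor], simp add: sum_mset_sweedler psi_sum_def mult.assoc)
  from tensor_lift_cong[OF add_congruence_tensor this]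
  have "tensor_lift AH psi_sum (tensor_lift HA (\<lambda>h a. {#(h * tR r, a)#}) X) =
      tensor_lift AH (\<lambda>m n. {#(lact_R r m, n)#}) (tensor_lift AH psi_sum X)"
    by (simp add: tensor_lift_comp[OF add_congruence_tensor psi_sum_balanced] comp)
  then show ?thesis by (simp add: psi_eq tensor_lact_def tensor_lift_def)
qed

text \<open>This is right linearity of the coaction, in the form \<open>psi_sum_ract\<close>;
  multiplication by \<open>sR r\<close> is well defined on the target because it commutes with the
  image of \<open>tR\<close>.\<close>

lemma psi_ract:
  "psi AH \<tau>R (tensor_ract HA ractR X r) = tensor_ract AH (\<lambda>h r. h * sR r) (psi AH \<tau>R X) r"
proof -
  have "balanced AH ractR (\<lambda>r h. h * tR r) (\<lambda>m n. {#(m, n * sR r)#})"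
    unfolding balanced_def
  proof (intro conjI allI)
    show "({#(ractR m b, n * sR r)#}, {#(m, n * tR b * sR r)#}) \<in> AH" for m b n
      using tensor_balanced[of ractR m b "n * sR r" "\<lambda>r h. h * tR r"]
      by (simp add: H.R.source_target_commute mult.assoc)
  qed (auto intro: biadditive_comp[OF biadditive_single] simp: distrib_right)
  note comp = tensor_lift_comp[OF add_congruence_tensor this]
  have "(psi_sum h (ractR a r), \<Sum>(m, n)\<in>#psi_sum h a. {#(m, n * sR r)#}) \<in> AH" for h a
    using psi_sum_ract[of h a r] by (simp add: sum_mset_sweedler psi_sum_def[of h a])
  from tensor_lift_cong[OF add_congruence_tensor this]
  have "tensor_lift AH psi_sum (tensor_lift HA (\<lambda>h a. {#(h, ractR a r)#}) X) =
      tensor_lift AH (\<lambda>m n. {#(m, n * sR r)#}) (tensor_lift AH psi_sum X)"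
    by (simp add: tensor_lift_comp[OF add_congruence_tensor psi_sum_balanced] comp)
  then show ?thesis by (simp add: psi_eq tensor_ract_def tensor_lift_def)
qed

end

theorem lemma4p1:
  fixes scL :: "'k::{comm_ring,comm_monoid_mult} \<Rightarrow> 'l::{ring,monoid_mult} \<Rightarrow> 'l"
    and scR :: "'k \<Rightarrow> 'r::{ring,monoid_mult} \<Rightarrow> 'r"
    and scH :: "'k \<Rightarrow> 'h::{ring,monoid_mult} \<Rightarrow> 'h"
    and sL tL :: "'l \<Rightarrow> 'h" and \<gamma>L :: "'h \<Rightarrow> ('h \<times> 'h) multiset set" and \<pi>L :: "'h \<Rightarrow> 'l"
    and sR tR :: "'r \<Rightarrow> 'h" and \<gamma>R :: "'h \<Rightarrow> ('h \<times> 'h) multiset set" and \<pi>R :: "'h \<Rightarrow> 'r"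
    and S :: "'h \<Rightarrow> 'h"
    and scA :: "'k \<Rightarrow> 'a::{ring,monoid_mult} \<Rightarrow> 'a"
    and ractL :: "'a \<Rightarrow> 'l \<Rightarrow> 'a" and ractR :: "'a \<Rightarrow> 'r \<Rightarrow> 'a"
    and \<tau>L \<tau>R :: "'a \<Rightarrow> ('a \<times> 'h) multiset set"
  assumes "hopf_algebroid scL scR scH sL tL \<gamma>L \<pi>L sR tR \<gamma>R \<pi>R S"
    and "bij S"
    and "hopf_comodule_algebra scL scR scH sL tL \<gamma>L \<pi>L sR tR \<gamma>R \<pi>R S scA ractL ractR \<tau>L \<tau>R"
  shows "let lactA = comodule_lact_R sR \<pi>R ractR \<tau>R;
             lactH = (\<lambda>r h. h * tR r);
             ractH = (\<lambda>h r. h * sR r);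
             HA = tensor ractH lactA;
             AH = tensor ractR lactH;
             \<psi> = psi AH \<tau>R
         in (\<forall>h a. \<psi> (HA `` {{#(h, a)#}}) = AH `` {sweedler (\<tau>R a) (\<lambda>a0 a1. {#(a0, h * a1)#})}) \<and>
            bimodule_isomorphism
              (UNIV // HA) (tensor_add HA) (tensor_lact HA lactH) (tensor_ract HA ractR)
              (UNIV // AH) (tensor_add AH) (tensor_lact AH lactA) (tensor_ract AH ractH) \<psi>"
proof -
  interpret hopf_comodule_algebra scL scR scH sL tL \<gamma>L \<pi>L sR tR \<gamma>R \<pi>R S scA ractL ractR \<tau>L \<tau>R
    by fact
  show ?thesis
    unfolding Let_def bimodule_isomorphism_def
  proof (intro conjI allI ballI psi_lact psi_ract)
    show "psi AH \<tau>R (HA `` {{#(h, a)#}}) = AH `` {sweedler (\<tau>R a) (\<lambda>a0 a1. {#(a0, h * a1)#})}" for h a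
      using psi_single by (simp add: psi_sum_def)
    show "bij_betw (psi AH \<tau>R) (UNIV // HA) (UNIV // AH)"
      unfolding psi_eq
      by (intro tensor_lift_bij[OF psi_sum_balanced psi_inv_sum_balanced] psi_inv_sum_psi_sum
          psi_sum_psi_inv_sum) fact+
    show "psi AH \<tau>R (tensor_add HA X Y) = tensor_add AH (psi AH \<tau>R X) (psi AH \<tau>R Y)" for X Y
      unfolding psi_eq by (rule tensor_lift_add[OF psi_sum_balanced])
  qed
qed

end
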